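(* Let $D$ be an integral domain satisfying the following conditions: ($\mathcal{C}1$) $D$ is polynomially L-regular; ($\mathcal{C}2$) for any nonnegative integer $n$ there exist only finitely many $t$-maximal ideals $\mathfrak{p}$ of $D$ with $N(\mathfrak{p})\le n$; ($\mathcal{C}3$) $\Pi_q$ is principal for every prime power $q$. For every $n$ let $\pi_n\in D$ be a generator of $\Pi_n$. Then $$\sigma_n=\prod_{1<k\le n}\pi_k^{-w_k(n)}$$ is a generator of $\mathfrak{I}_n(D)$ for all $n$, and therefore $\operatorname{Int}(D)$ has a regular basis. For all $n$ and all integers $k>1$, let $F_n=\frac{X^n-X}{\pi_n}\in\operatorname{Int}(D)$ and let $F_{k,n}=\prod_{i=0}^r (F_k^{\circ i})^{n_i}\in\operatorname{Int}(D)$, where $n=n_0+n_1k+\cdots+n_rk^r$ is the $k$-adic expansion of $n$. Then $F_{k,n}$ has degree $n$ and leading coefficient $\pi_k^{-w_k(n)}$ for all $n,k$. For every integer $n>1$ there exist $a_{2,n},a_{3,n},\ldots,a_{n,n}\in D$ such that $$\sigma_n=\sum_{1<k\le n}a_{k,n}\pi_k^{-w_k(n)}.$$ Let $G_0=1$, $G_1=X$, and $G_n=\sum_{1<k\le n}a_{k,n}F_{k,n}$ for all $n>1$. Then $G_n\in\operatorname{Int}(D)$ has degree $n$ and leading coefficient $\sigma_n$ for every $n$, and therefore $\{G_0,G_1,G_2,\ldots\}$ is a regular basis of $\operatorname{Int}(D)$.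
   Context: Let $D$ be an integral domain with quotient field $K$. $\operatorname{Int}(D)=\{f\in K[X]: f(D)\subseteq D\}$. The $n$th characteristic ideal $\mathfrak{I}_n(D)\subseteq K$ is the set of coefficients of $X^n$ of the polynomials in $\operatorname{Int}(D)$ of degree at most $n$; it is a (nonzero) fractional ideal of $D$. A regular basis of $\operatorname{Int}(D)$ is a $D$-module basis consisting of exactly one polynomial of each degree. For a polynomial $f$, $f^{\circ i}$ denotes the $i$-fold composition of $f$ with itself, with $f^{\circ 0}=X$. For a nonzero fractional ideal $I$ of $D$, $I^{-1}=\{x\in K: xI\subseteq D\}$, $I_v=(I^{-1})^{-1}$, and $I_t=\bigcup J_v$ over the nonzero finitely generated $J\subseteq I$; $I$ is a $t$-ideal if $I_t=I$. A $t$-maximal ideal of $D$ is an ideal maximal among the nonzero proper ideals of $D$ that are $t$-ideals. The norm of an ideal $\mathfrak{a}$ is $N(\mathfrak{a})=|D/\mathfrak{a}|$. For a nonnegative integer $n$, $\Pi_n=\Pi_n(D)$ is the intersection of all $t$-maximal ideals of $D$ of norm $n$ (equal to $D$ if there are none, in particular if $n$ is not a prime power). $D$ is polynomially L-regular if $S^{-1}\operatorname{Int}(D)=\operatorname{Int}(S^{-1}D)$ for every multiplicative subset $S$ of $D$ (with $0\notin S$). For a nonnegative integer $n$ and an integer $k>1$, $w_k(n)=\sum_{i=1}^\infty\lfloor n/k^i\rfloor$. *)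

theory Defs
  imports
    "HOL-Computational_Algebra.Polynomial"
    "HOL-Library.Extended_Nat"
    "HOL-Number_Theory.Prime_Powers"
begin

text \<open>
  An integral domain with quotient field \<open>K\<close> is represented as a subset \<open>D\<close> of the field type \<open>K\<close>.
  Localizations of \<open>D\<close> are then again subsets of \<open>K\<close>.
\<close>

definition domain_with_quotient_field :: "'k::field set \<Rightarrow> bool" where
  "domain_with_quotient_field D \<longleftrightarrow>
     1 \<in> D \<and> (\<forall>x\<in>D. \<forall>y\<in>D. x - y \<in> D \<and> x * y \<in> D) \<and>
     (\<forall>z. \<exists>x\<in>D. \<exists>y\<in>D. y \<noteq> 0 \<and> z = x / y)"

definition span_over :: "'k set \<Rightarrow> ('k \<Rightarrow> 'b \<Rightarrow> 'b::comm_monoid_add) \<Rightarrow> 'b set \<Rightarrow> 'b set" where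
  "span_over D scale B =
     {\<Sum>b\<in>F. scale (c b) b |F c. finite F \<and> F \<subseteq> B \<and> (\<forall>b\<in>F. c b \<in> D)}"

definition module_basis ::
    "'k::zero set \<Rightarrow> ('k \<Rightarrow> 'b \<Rightarrow> 'b::comm_monoid_add) \<Rightarrow> 'b set \<Rightarrow> 'b set \<Rightarrow> bool" where
  "module_basis D scale M B \<longleftrightarrow>
     span_over D scale B = M \<and>
     (\<forall>F c. finite F \<and> F \<subseteq> B \<and> (\<forall>b\<in>F. c b \<in> D) \<and> (\<Sum>b\<in>F. scale (c b) b) = 0
        \<longrightarrow> (\<forall>b\<in>F. c b = 0))"

definition cyclic_module :: "'k::field set \<Rightarrow> 'k \<Rightarrow> 'k set" where
  "cyclic_module D x = (\<lambda>d. d * x) ` D"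

definition ideal_of :: "'k::field set \<Rightarrow> 'k set \<Rightarrow> bool" where
  "ideal_of D I \<longleftrightarrow>
     I \<subseteq> D \<and> 0 \<in> I \<and> (\<forall>x\<in>I. \<forall>y\<in>I. x + y \<in> I) \<and> (\<forall>d\<in>D. \<forall>x\<in>I. d * x \<in> I)"

definition principal_ideal_of :: "'k::field set \<Rightarrow> 'k set \<Rightarrow> bool" where
  "principal_ideal_of D I \<longleftrightarrow> (\<exists>x\<in>D. I = cyclic_module D x)"


subsection \<open>The \<open>t\<close>-operation\<close>

definition frac_inverse :: "'k::field set \<Rightarrow> 'k set \<Rightarrow> 'k set" where
  "frac_inverse D I = {x. \<forall>y\<in>I. x * y \<in> D}"

definition v_closure :: "'k::field set \<Rightarrow> 'k set \<Rightarrow> 'k set" where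
  "v_closure D I = frac_inverse D (frac_inverse D I)"

definition t_closure :: "'k::field set \<Rightarrow> 'k set \<Rightarrow> 'k set" where
  "t_closure D I =
     \<Union> {v_closure D J |J. J \<subseteq> I \<and> J \<noteq> {0} \<and> (\<exists>A. finite A \<and> J = span_over D (*) A)}"

definition proper_t_ideal :: "'k::field set \<Rightarrow> 'k set \<Rightarrow> bool" where
  "proper_t_ideal D I \<longleftrightarrow> ideal_of D I \<and> I \<noteq> {0} \<and> I \<noteq> D \<and> t_closure D I = I"

definition t_maximal :: "'k::field set \<Rightarrow> 'k set \<Rightarrow> bool" where
  "t_maximal D P \<longleftrightarrow>
     proper_t_ideal D P \<and> (\<forall>I. proper_t_ideal D I \<and> P \<subseteq> I \<longrightarrow> I = P)"

definition residues_mod :: "'k::field set \<Rightarrow> 'k set \<Rightarrow> 'k set set" where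
  "residues_mod D I = D // {(x, y). x \<in> D \<and> y \<in> D \<and> x - y \<in> I}"

text \<open>
  The norm takes values in \<open>enat\<close>, because \<open>card\<close> is \<open>0\<close> on infinite sets.
\<close>

definition ideal_norm :: "'k::field set \<Rightarrow> 'k set \<Rightarrow> enat" where
  "ideal_norm D I =
     (if finite (residues_mod D I) then enat (card (residues_mod D I)) else \<infinity>)"

text \<open>
  Intersecting with \<open>D\<close> matters only when there is no \<open>t\<close>-maximal ideal of norm \<open>n\<close>.
\<close>

definition Pi_ideal :: "'k::field set \<Rightarrow> nat \<Rightarrow> 'k set" where
  "Pi_ideal D n = D \<inter> \<Inter> {P. t_maximal D P \<and> ideal_norm D P = enat n}"


subsection \<open>Integer-valued polynomials\<close>

definition int_valued :: "'k::field set \<Rightarrow> 'k poly set" where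
  "int_valued D = {f. \<forall>x\<in>D. poly f x \<in> D}"

definition char_ideal :: "'k::field set \<Rightarrow> nat \<Rightarrow> 'k set" where
  "char_ideal D n = {coeff f n |f. f \<in> int_valued D \<and> degree f \<le> n}"

definition regular_basis :: "'k::field set \<Rightarrow> 'k poly set \<Rightarrow> bool" where
  "regular_basis D B \<longleftrightarrow>
     module_basis D smult (int_valued D) B \<and> (\<forall>n. \<exists>!f. f \<in> B \<and> degree f = n)"

definition multiplicative_subset :: "'k::field set \<Rightarrow> 'k set \<Rightarrow> bool" where
  "multiplicative_subset D S \<longleftrightarrow>
     S \<subseteq> D \<and> 1 \<in> S \<and> 0 \<notin> S \<and> (\<forall>x\<in>S. \<forall>y\<in>S. x * y \<in> S)"

definition localization :: "'k::field set \<Rightarrow> 'k set \<Rightarrow> 'k set" where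
  "localization S D = {x / s |x s. x \<in> D \<and> s \<in> S}"

definition poly_localization :: "'k::field set \<Rightarrow> 'k poly set \<Rightarrow> 'k poly set" where
  "poly_localization S A = {smult (inverse s) f |f s. f \<in> A \<and> s \<in> S}"

definition polynomially_L_regular :: "'k::field set \<Rightarrow> bool" where
  "polynomially_L_regular D \<longleftrightarrow>
     (\<forall>S. multiplicative_subset D S \<longrightarrow>
        poly_localization S (int_valued D) = int_valued (localization S D))"


subsection \<open>The polynomials of the regular basis\<close>

text \<open>Only finitely many terms of this sum are nonzero if \<open>k > 1\<close>.\<close>

definition w :: "nat \<Rightarrow> nat \<Rightarrow> nat" where
  "w k n = (\<Sum>i. n div k ^ Suc i)"

definition sigma :: "(nat \<Rightarrow> 'k::field) \<Rightarrow> nat \<Rightarrow> 'k" where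
  "sigma \<pi> n = (\<Prod>k\<in>{1<..n}. \<pi> k powi - int (w k n))"

definition iter_comp :: "'k::field poly \<Rightarrow> nat \<Rightarrow> 'k poly" where
  "iter_comp f i = (pcompose f ^^ i) [:0, 1:]"

definition F_poly :: "(nat \<Rightarrow> 'k::field) \<Rightarrow> nat \<Rightarrow> 'k poly" where
  "F_poly \<pi> n = smult (inverse (\<pi> n)) (monom 1 n - [:0, 1:])"

text \<open>
  The \<open>i\<close>-th \<open>k\<close>-adic digit of \<open>n\<close> is \<open>n div k ^ i mod k\<close>, and the positions of the digits up to the
  leading one are the \<open>i\<close> with \<open>k ^ i \<le> n\<close>.
\<close>

definition F_digit_poly :: "(nat \<Rightarrow> 'k::field) \<Rightarrow> nat \<Rightarrow> nat \<Rightarrow> 'k poly" where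
  "F_digit_poly \<pi> k n =
     (\<Prod>i | k ^ i \<le> n. iter_comp (F_poly \<pi> k) i ^ (n div k ^ i mod k))"

definition G_poly :: "(nat \<Rightarrow> 'k::field) \<Rightarrow> (nat \<Rightarrow> nat \<Rightarrow> 'k) \<Rightarrow> nat \<Rightarrow> 'k poly" where
  "G_poly \<pi> a n =
     (if n = 0 then 1 else if n = 1 then [:0, 1:]
      else \<Sum>k\<in>{1<..n}. smult (a k n) (F_digit_poly \<pi> k n))"

end

theory Submission
  imports Defs
begin

text \<open>
  Every \<open>t\<close>-maximal ideal is prime, so one of finite norm \<open>q\<close> has residue field \<open>\<bbbF>\<^sub>q\<close>; hence
  \<open>X\<^sup>q - X\<close> maps \<open>D\<close> into \<open>\<Pi>\<^sub>q\<close>, and the generators \<open>\<pi>\<^sub>j\<close>, \<open>\<pi>\<^sub>k\<close> are comaximal for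
  \<open>j \<noteq> k\<close>. Clearing denominators in \<open>\<sigma>\<^sub>n = \<Sum> a\<^sub>k \<pi>\<^sub>k ^ (- w\<^sub>k(n))\<close> leaves a partition of
  unity for the pairwise comaximal elements \<open>\<pi>\<^sub>k ^ w\<^sub>k(n)\<close>, which gives the \<open>a\<^sub>k\<close> and thus \<open>G\<^sub>n\<close>.

  Conversely, let \<open>c\<close> be the coefficient of \<open>X\<^sup>n\<close> of an integer-valued polynomial of degree at most
  \<open>n\<close>. As \<open>D\<close> is the intersection of its localizations at \<open>t\<close>-maximal ideals \<open>P\<close>, it suffices that
  \<open>c / \<sigma>\<^sub>n\<close> lies in each of them. Lagrange interpolation writes \<open>c\<close> as a sum of values
  over products of differences of \<open>n + 1\<close> points of \<open>D\<close>. If \<open>P\<close> has norm greater than \<open>n\<close>, the points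
  can be chosen pairwise incongruent modulo \<open>P\<close>; if it has norm \<open>q \<le> n\<close>, they are obtained from the
  \<open>q\<close>-adic expansions of \<open>0, \<dots>, n\<close> by replacing digits by residues and \<open>q\<close> by \<open>\<pi>\<^sub>q\<close>, and
  counting congruences modulo powers of \<open>q\<close> shows that the products divide \<open>\<pi>\<^sub>q ^ w\<^sub>q(n)\<close> locally.
\<close>


subsection \<open>Prime ideals and the \<open>t\<close>-operation\<close>

locale domain_in_field =
  fixes D :: "'k::field set"
  assumes dom: "domain_with_quotient_field D"
begin

lemma one_mem [simp]: "1 \<in> D"
  and diff_mem: "x \<in> D \<Longrightarrow> y \<in> D \<Longrightarrow> x - y \<in> D"
  and mult_mem: "x \<in> D \<Longrightarrow> y \<in> D \<Longrightarrow> x * y \<in> D"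
  using dom by (auto simp: domain_with_quotient_field_def)

lemma fraction_cases:
  obtains x y where "x \<in> D" "y \<in> D" "y \<noteq> 0" "z = x / y"
  using dom unfolding domain_with_quotient_field_def by blast

lemma zero_mem [simp]: "0 \<in> D"
  using diff_mem[of 1 1] by simp

lemma uminus_mem: "x \<in> D \<Longrightarrow> - x \<in> D"
  using diff_mem[of 0 x] by simp

lemma add_mem: "x \<in> D \<Longrightarrow> y \<in> D \<Longrightarrow> x + y \<in> D"
  using diff_mem[of x "- y"] uminus_mem by simp

lemma power_mem: "x \<in> D \<Longrightarrow> x ^ n \<in> D"
  by (induction n) (auto intro: mult_mem)

lemma sum_mem: "(\<And>i. i \<in> A \<Longrightarrow> f i \<in> D) \<Longrightarrow> sum f A \<in> D"
  by (induction A rule: infinite_finite_induct) (auto intro: add_mem)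

lemma prod_mem: "(\<And>i. i \<in> A \<Longrightarrow> f i \<in> D) \<Longrightarrow> prod f A \<in> D"
  by (induction A rule: infinite_finite_induct) (auto intro: mult_mem)

lemmas mem_intros = diff_mem mult_mem uminus_mem add_mem power_mem sum_mem prod_mem

lemma ideal_subset: "ideal_of D I \<Longrightarrow> x \<in> I \<Longrightarrow> x \<in> D"
  and ideal_zero: "ideal_of D I \<Longrightarrow> 0 \<in> I"
  and ideal_add: "ideal_of D I \<Longrightarrow> x \<in> I \<Longrightarrow> y \<in> I \<Longrightarrow> x + y \<in> I"
  and ideal_mult_left: "ideal_of D I \<Longrightarrow> d \<in> D \<Longrightarrow> x \<in> I \<Longrightarrow> d * x \<in> I"
  by (auto simp: ideal_of_def)

lemma ideal_mult_right: "ideal_of D I \<Longrightarrow> d \<in> D \<Longrightarrow> x \<in> I \<Longrightarrow> x * d \<in> I"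
  using ideal_mult_left by (simp add: mult.commute)

lemma ideal_uminus: "ideal_of D I \<Longrightarrow> x \<in> I \<Longrightarrow> - x \<in> I"
  using ideal_mult_left[of I "-1" x] uminus_mem by simp

lemma ideal_diff: "ideal_of D I \<Longrightarrow> x \<in> I \<Longrightarrow> y \<in> I \<Longrightarrow> x - y \<in> I"
  using ideal_add[of I x "- y"] ideal_uminus by auto

lemma ideal_sum: "ideal_of D I \<Longrightarrow> (\<And>i. i \<in> A \<Longrightarrow> f i \<in> I) \<Longrightarrow> sum f A \<in> I"
  by (induction A rule: infinite_finite_induct) (auto intro: ideal_zero ideal_add)

lemma ideal_prod:
  assumes "ideal_of D I" "finite A" "i \<in> A" "f i \<in> I" "\<And>j. j \<in> A \<Longrightarrow> f j \<in> D"
  shows "prod f A \<in> I"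
proof -
  have "prod f A = f i * prod f (A - {i})"
    using assms by (simp add: prod.remove)
  then show ?thesis
    using assms by (auto intro: ideal_mult_right prod_mem)
qed

lemma ideal_cong_trans: "ideal_of D I \<Longrightarrow> x - y \<in> I \<Longrightarrow> y - z \<in> I \<Longrightarrow> x - z \<in> I"
  using ideal_add[of I "x - y" "y - z"] by simp

lemma ideal_cong_sym: "ideal_of D I \<Longrightarrow> x - y \<in> I \<Longrightarrow> y - x \<in> I"
  using ideal_uminus[of I "x - y"] by simp

lemma ideal_cong_mult:
  assumes "ideal_of D I" "a - b \<in> I" "c - d \<in> I" "a \<in> D" "d \<in> D"
  shows "a * c - b * d \<in> I"
proof -
  have "a * c - b * d = a * (c - d) + (a - b) * d"
    by (simp add: algebra_simps)
  then show ?thesis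
    using assms by (simp add: ideal_add ideal_mult_left ideal_mult_right)
qed

lemma ideal_cong_prod:
  assumes "ideal_of D I" "finite A"
    and "\<And>i. i \<in> A \<Longrightarrow> f i \<in> D \<and> g i \<in> D \<and> f i - g i \<in> I"
  shows "prod f A - prod g A \<in> I"
  using assms(2,3)
  by (induction A rule: finite_induct) (auto intro!: assms(1) ideal_zero ideal_cong_mult prod_mem)

section \<open>Spans, \<open>v\<close>-closures and a criterion for \<open>t\<close>-ideals\<close>

lemma span_over_superset: "a \<in> A \<Longrightarrow> a \<in> span_over D (*) A"
  unfolding span_over_def by (auto intro!: exI[of _ "{a}"] exI[of _ "\<lambda>_. 1"])

lemma zero_in_span_over: "0 \<in> span_over D (*) A"
  unfolding span_over_def by (auto intro!: exI[of _ "{}"])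

lemma span_over_subset_ideal: "ideal_of D I \<Longrightarrow> A \<subseteq> I \<Longrightarrow> span_over D (*) A \<subseteq> I"
  unfolding span_over_def by (auto intro!: ideal_sum ideal_mult_left)

text \<open>Multiplication by a nonzero \<open>a\<close> is injective, so the coefficient of
  \<open>x\<close> can be reattached to \<open>x * a\<close>.\<close>

lemma span_over_mult:
  assumes "z \<in> span_over D (*) A" "a \<noteq> 0"
  shows "z * a \<in> span_over D (*) ((\<lambda>x. x * a) ` A)"
proof -
  obtain F c where F: "finite F" "F \<subseteq> A" "\<forall>b\<in>F. c b \<in> D" and z: "z = (\<Sum>b\<in>F. c b * b)"
    using assms(1) by (auto simp: span_over_def)
  have "inj_on (\<lambda>x. x * a) F"
    using assms(2) by (auto intro: inj_onI)
  then have "z * a = (\<Sum>b\<in>(\<lambda>x. x * a) ` F. c (b / a) * b)"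
    using assms(2) by (simp add: z sum.reindex sum_distrib_right mult.assoc)
  moreover have "\<forall>b\<in>(\<lambda>x. x * a) ` F. c (b / a) \<in> D"
    using F(3) assms(2) by simp
  ultimately show ?thesis
    using F(1,2) unfolding span_over_def
    by (intro CollectI exI[of _ "(\<lambda>x. x * a) ` F"] exI[of _ "\<lambda>b. c (b / a)"]) auto
qed

lemma v_closure_superset: "A \<subseteq> v_closure D A"
  by (auto simp: v_closure_def frac_inverse_def mult.commute)

text \<open>Both \<open>1\<close> and \<open>x\<close> lie in the inverse of \<open>A\<close>, so
  multiplying an element of the \<open>v\<close>-closure by either of them lands in
  \<open>D\<close>.\<close>

lemma v_closure_subset_colon:
  assumes "A \<subseteq> {d \<in> D. d * x \<in> D}"
  shows "v_closure D A \<subseteq> {d \<in> D. d * x \<in> D}"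
proof
  fix y
  assume "y \<in> v_closure D A"
  then have y: "y * z \<in> D" if "z \<in> frac_inverse D A" for z
    using that by (auto simp: v_closure_def frac_inverse_def)
  have "1 \<in> frac_inverse D A" "x \<in> frac_inverse D A"
    using assms by (auto simp: frac_inverse_def mult.commute)
  then show "y \<in> {d \<in> D. d * x \<in> D}"
    using y[of 1] y[of x] by simp
qed

text \<open>Only finite generating sets need testing: the inclusion of \<open>I\<close> in its
  \<open>t\<close>-closure is automatic, by means of principal submodules.\<close>

lemma proper_t_idealI:
  assumes I: "ideal_of D I" "I \<noteq> {0}" "I \<noteq> D"
    and fin: "\<And>A. finite A \<Longrightarrow> A \<subseteq> I \<Longrightarrow> span_over D (*) A \<noteq> {0} \<Longrightarrow>
           v_closure D (span_over D (*) A) \<subseteq> I"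
  shows "proper_t_ideal D I"
proof -
  have "t_closure D I \<subseteq> I"
  proof
    fix y
    assume "y \<in> t_closure D I"
    then obtain A where A: "finite A" "span_over D (*) A \<subseteq> I" "span_over D (*) A \<noteq> {0}"
        "y \<in> v_closure D (span_over D (*) A)"
      unfolding t_closure_def by auto
    moreover have "A \<subseteq> I"
      using A(2) span_over_superset by blast
    ultimately show "y \<in> I"
      using fin by blast
  qed
  moreover have "I \<subseteq> t_closure D I"
  proof
    fix y
    assume y: "y \<in> I"
    \<comment> \<open>\<open>t_closure\<close> excludes the module \<open>{0}\<close>, so a nonzero
      generator is needed. For \<open>y = 0\<close> any nonzero element of \<open>I\<close> serves,
      since every span contains \<open>0\<close>.\<close>
    obtain b where b: "b \<in> I" "b \<noteq> 0" "y = 0 \<or> y = b"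
      using I(1,2) y ideal_zero by (cases "y = 0") blast+
    let ?J = "span_over D (*) {b}"
    have "b \<in> ?J" "y \<in> ?J"
      using b(3) span_over_superset[of b "{b}"] zero_in_span_over by auto
    then have "?J \<subseteq> I" "?J \<noteq> {0}" "y \<in> v_closure D ?J"
      using b I(1) span_over_subset_ideal[of I "{b}"] v_closure_superset by auto
    moreover have "\<exists>A. finite A \<and> ?J = span_over D (*) A"
      by blast
    ultimately show "y \<in> t_closure D I"
      unfolding t_closure_def by blast
  qed
  ultimately show ?thesis
    using I by (auto simp: proper_t_ideal_def)
qed

lemma proper_t_idealD:
  assumes "proper_t_ideal D I" "finite A" "A \<subseteq> I" "span_over D (*) A \<noteq> {0}"
  shows "v_closure D (span_over D (*) A) \<subseteq> I"
proof -
  have "ideal_of D I" "t_closure D I = I"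
    using assms(1) by (auto simp: proper_t_ideal_def)
  then have "span_over D (*) A \<subseteq> I"
    using assms(3) span_over_subset_ideal by blast
  then have "v_closure D (span_over D (*) A) \<subseteq> t_closure D I"
    unfolding t_closure_def using assms(2,4) by blast
  then show ?thesis
    using \<open>t_closure D I = I\<close> by simp
qed

lemma proper_t_ideal_ideal: "proper_t_ideal D I \<Longrightarrow> ideal_of D I"
  by (simp add: proper_t_ideal_def)

lemma proper_t_ideal_one_notin: "proper_t_ideal D I \<Longrightarrow> 1 \<notin> I"
  unfolding proper_t_ideal_def ideal_of_def by force

text \<open>The ideal of denominators of \<open>x\<close> contains the denominator of any fraction
  for \<open>x\<close>, but not \<open>1\<close>. It even contains the \<open>v\<close>-closure of
  each of its subsets.\<close>

lemma proper_t_ideal_colon: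
  assumes "x \<notin> D"
  shows "proper_t_ideal D {d \<in> D. d * x \<in> D}" (is "proper_t_ideal D ?I")
proof (rule proper_t_idealI)
  show ideal: "ideal_of D ?I"
    by (auto simp: ideal_of_def distrib_right mult.assoc intro: mem_intros)
  obtain a b where "a \<in> D" "b \<in> D" "b \<noteq> 0" "x = a / b"
    by (rule fraction_cases)
  then have "b \<in> ?I"
    by simp
  then show "?I \<noteq> {0}"
    using \<open>b \<noteq> 0\<close> by blast
  have "1 \<notin> ?I"
    using assms by simp
  then show "?I \<noteq> D"
    using one_mem by metis
  show "v_closure D (span_over D (*) A) \<subseteq> ?I" if "A \<subseteq> ?I" for A
    using that by (intro v_closure_subset_colon span_over_subset_ideal ideal)
qed

text \<open>The \<open>t\<close>-operation has finite character: a finite subset of the union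
  already lies in one member of the chain. This makes Zorn's lemma applicable.\<close>

lemma proper_t_ideal_Union_chain:
  assumes "\<C> \<noteq> {}" and chain: "subset.chain {J. proper_t_ideal D J} \<C>"
  shows "proper_t_ideal D (\<Union>\<C>)"
proof (rule proper_t_idealI)
  have t: "proper_t_ideal D J" if "J \<in> \<C>" for J
    using chain that by (auto simp: subset.chain_def)
  have total: "I \<subseteq> J \<or> J \<subseteq> I" if "I \<in> \<C>" "J \<in> \<C>" for I J
    using chain that by (auto simp: subset_chain_def)
  obtain J where J: "J \<in> \<C>"
    using assms(1) by blast
  have add: "x + y \<in> \<Union>\<C>" if "x \<in> \<Union>\<C>" "y \<in> \<Union>\<C>" for x y
  proof -
    obtain I where "I \<in> \<C>" "x \<in> I" "y \<in> I"
      using \<open>x \<in> \<Union>\<C>\<close> \<open>y \<in> \<Union>\<C>\<close> total by blast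
    then show ?thesis
      using t proper_t_ideal_ideal ideal_add by blast
  qed
  show "ideal_of D (\<Union>\<C>)"
    unfolding ideal_of_def
  proof (intro conjI ballI add)
    show "\<Union>\<C> \<subseteq> D" "0 \<in> \<Union>\<C>"
      using J t proper_t_ideal_ideal ideal_subset ideal_zero by blast+
    show "d * x \<in> \<Union>\<C>" if "d \<in> D" "x \<in> \<Union>\<C>" for d x
      using that t proper_t_ideal_ideal ideal_mult_left by blast
  qed
  have "J \<noteq> {}" "J \<noteq> {0}"
    using t[OF J] by (auto simp: proper_t_ideal_def ideal_of_def)
  then obtain b where "b \<in> J" "b \<noteq> 0"
    by blast
  then have "b \<in> \<Union>\<C>"
    using J by blast
  then show "\<Union>\<C> \<noteq> {0}"
    using \<open>b \<noteq> 0\<close> by auto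
  have "1 \<notin> \<Union>\<C>"
    using t proper_t_ideal_one_notin by auto
  then show "\<Union>\<C> \<noteq> D"
    using one_mem by metis
  show "v_closure D (span_over D (*) A) \<subseteq> \<Union>\<C>"
    if A: "finite A" "A \<subseteq> \<Union>\<C>" "span_over D (*) A \<noteq> {0}" for A
  proof -
    obtain I where "I \<in> \<C>" "A \<subseteq> I"
      using finite_subset_Union_chain[OF A(1,2) assms] by blast
    then show ?thesis
      using t proper_t_idealD[of I A] A by blast
  qed
qed

text \<open>Zorn's lemma is applied to the proper \<open>t\<close>-ideals above \<open>I\<close>. A
  maximal one among them is \<open>t\<close>-maximal, since everything above it also contains
  \<open>I\<close>.\<close>

lemma t_maximal_exists:
  assumes "proper_t_ideal D I"
  obtains P where "t_maximal D P" "I \<subseteq> P"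
proof -
  let ?A = "{J. proper_t_ideal D J \<and> I \<subseteq> J}"
  have "\<exists>P\<in>?A. \<forall>X\<in>?A. P \<subseteq> X \<longrightarrow> X = P"
  proof (rule subset_Zorn_nonempty)
    show "?A \<noteq> {}"
      using assms by blast
    show "\<Union>\<C> \<in> ?A" if "\<C> \<noteq> {}" "subset.chain ?A \<C>" for \<C>
    proof -
      have "subset.chain {J. proper_t_ideal D J} \<C>"
        using that(2) by (auto simp: subset.chain_def)
      then have "proper_t_ideal D (\<Union>\<C>)"
        using that(1) by (rule proper_t_ideal_Union_chain[rotated])
      moreover have "I \<subseteq> J" if "J \<in> \<C>" for J
        using that \<open>subset.chain ?A \<C>\<close> by (auto simp: subset.chain_def)
      ultimately show ?thesis
        using \<open>\<C> \<noteq> {}\<close> by blast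
    qed
  qed
  then obtain P where P: "P \<in> ?A" "\<forall>X\<in>?A. P \<subseteq> X \<longrightarrow> X = P" ..
  have "t_maximal D P"
    unfolding t_maximal_def
  proof (intro conjI allI impI)
    show "proper_t_ideal D P"
      using P(1) by simp
    show "X = P" if "proper_t_ideal D X \<and> P \<subseteq> X" for X
      using P that by auto
  qed
  then show ?thesis
    using P(1) that by blast
qed

lemma t_maximal_ideal: "t_maximal D P \<Longrightarrow> ideal_of D P"
  and t_maximal_one_notin: "t_maximal D P \<Longrightarrow> 1 \<notin> P"
  by (simp_all add: t_maximal_def proper_t_ideal_ideal proper_t_ideal_one_notin)

lemma t_maximal_subset_eq: "t_maximal D P \<Longrightarrow> t_maximal D Q \<Longrightarrow> P \<subseteq> Q \<Longrightarrow> P = Q"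
  unfolding t_maximal_def by metis

text \<open>The colon ideal \<open>(P : a)\<close> is again a \<open>t\<close>-ideal, so it is \<open>P\<close> by maximality.\<close>

lemma t_maximal_prime:
  assumes P: "t_maximal D P" and ab: "a \<in> D" "b \<in> D" "a * b \<in> P" and "a \<notin> P"
  shows "b \<in> P"
proof -
  have t: "proper_t_ideal D P" and ideal: "ideal_of D P"
    using P by (auto simp: t_maximal_def proper_t_ideal_def)
  have "a \<noteq> 0"
    using \<open>a \<notin> P\<close> ideal ideal_zero by blast
  let ?Q = "{d \<in> D. d * a \<in> P}"
  have PQ: "P \<subseteq> ?Q"
    using ideal ab(1) by (auto intro: ideal_mult_right ideal_subset)
  have idealQ: "ideal_of D ?Q"
    using ideal by (auto simp: ideal_of_def distrib_right mult.assoc intro: mem_intros)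
  have "proper_t_ideal D ?Q"
  proof (rule proper_t_idealI[OF idealQ])
    show "?Q \<noteq> {0}"
      using t PQ ideal_zero[OF ideal] unfolding proper_t_ideal_def by blast
    have "1 \<notin> ?Q"
      using \<open>a \<notin> P\<close> by simp
    then show "?Q \<noteq> D"
      using one_mem by metis
    show "v_closure D (span_over D (*) A) \<subseteq> ?Q"
      if A: "finite A" "A \<subseteq> ?Q" "span_over D (*) A \<noteq> {0}" for A
    proof
      fix y
      assume "y \<in> v_closure D (span_over D (*) A)"
      then have y: "y * z \<in> D" if "z \<in> frac_inverse D (span_over D (*) A)" for z
        using that by (auto simp: v_closure_def frac_inverse_def)
      let ?B = "(\<lambda>x. x * a) ` A"
      have span: "z * a \<in> span_over D (*) ?B" if "z \<in> span_over D (*) A" for z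
        using that \<open>a \<noteq> 0\<close> by (rule span_over_mult)
      obtain z where "z \<in> span_over D (*) A" "z \<noteq> 0"
        using A(3) zero_in_span_over by blast
      then have nz: "span_over D (*) ?B \<noteq> {0}"
        using span \<open>a \<noteq> 0\<close> by force
      \<comment> \<open>Inverses shift in the opposite direction: if \<open>z\<close> multiplies the
        span of \<open>?B\<close> into \<open>D\<close>, then \<open>a * z\<close> does so for the
        span of \<open>A\<close>. Hence \<open>y * a\<close> lies in the \<open>v\<close>-closure of
        the span of \<open>?B\<close>, which \<open>P\<close> contains.\<close>
      have "a * z \<in> frac_inverse D (span_over D (*) A)"
        if "z \<in> frac_inverse D (span_over D (*) ?B)" for z
        using that span by (fastforce simp: frac_inverse_def mult_ac)
      then have "y * a \<in> v_closure D (span_over D (*) ?B)"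
        using y unfolding v_closure_def by (fastforce simp: frac_inverse_def mult.assoc)
      then have "y * a \<in> P"
        using proper_t_idealD[OF t _ _ nz] A(1,2) by auto
      moreover have "1 \<in> frac_inverse D (span_over D (*) A)"
        using span_over_subset_ideal[OF idealQ A(2)] by (auto simp: frac_inverse_def)
      ultimately show "y \<in> ?Q"
        using y[of 1] by simp
    qed
  qed
  then have "?Q = P"
    using P PQ unfolding t_maximal_def by blast
  moreover have "b \<in> ?Q"
    using ab by (simp add: mult.commute)
  ultimately show ?thesis
    by metis
qed

lemma t_maximal_mult_notin:
  "t_maximal D P \<Longrightarrow> a \<in> D - P \<Longrightarrow> b \<in> D - P \<Longrightarrow> a * b \<in> D - P"
  using t_maximal_prime mult_mem by blast

lemma t_maximal_prod_notin:
  "t_maximal D P \<Longrightarrow> (\<And>i. i \<in> A \<Longrightarrow> f i \<in> D - P) \<Longrightarrow> prod f A \<in> D - P"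
  by (induction A rule: infinite_finite_induct)
    (use t_maximal_mult_notin t_maximal_one_notin in auto)

text \<open>That is, \<open>D\<close> is the intersection of its localizations at the \<open>t\<close>-maximal ideals.\<close>

lemma memI_t_maximal:
  assumes "\<And>P. t_maximal D P \<Longrightarrow> \<exists>s\<in>D - P. s * x \<in> D"
  shows "x \<in> D"
proof (rule ccontr)
  assume "x \<notin> D"
  \<comment> \<open>The denominators of an \<open>x\<close> outside \<open>D\<close> form a proper
    \<open>t\<close>-ideal, so some \<open>P\<close> contains all of them.\<close>
  then obtain P where P: "t_maximal D P" "{d \<in> D. d * x \<in> D} \<subseteq> P"
    by (rule t_maximal_exists[OF proper_t_ideal_colon])
  then obtain s where "s \<in> D - P" "s * x \<in> D"
    using assms by auto
  then show False
    using P(2) by auto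
qed

section \<open>Residue classes and Fermat's theorem modulo a \<open>t\<close>-maximal ideal\<close>

lemma residue_transversal:
  assumes I: "ideal_of D I"
  obtains R where "R \<subseteq> D" "\<And>x. x \<in> D \<Longrightarrow> \<exists>r\<in>R. x - r \<in> I"
    "\<And>r s. r \<in> R \<Longrightarrow> s \<in> R \<Longrightarrow> r - s \<in> I \<Longrightarrow> r = s"
    "ideal_norm D I = (if finite R then enat (card R) else \<infinity>)"
proof -
  define \<rho> where "\<rho> = {(x, y). x \<in> D \<and> y \<in> D \<and> x - y \<in> I}"
  have equiv: "equiv D \<rho>"
  proof (rule equivI)
    show "\<rho> \<subseteq> D \<times> D"
      by (auto simp: \<rho>_def)
    show "refl_on D \<rho>"
      using ideal_zero[OF I] by (simp add: refl_on_def \<rho>_def)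
    show "sym \<rho>"
      by (rule symI) (auto simp: \<rho>_def intro: ideal_cong_sym[OF I])
    show "trans \<rho>"
      by (rule transI) (auto simp: \<rho>_def intro: ideal_cong_trans[OF I])
  qed
  define f where "f C = (SOME x. x \<in> C)" for C :: "'k set"
  have f: "f C \<in> C" if "C \<in> D // \<rho>" for C
    unfolding f_def using in_quotient_imp_non_empty[OF equiv that] by (simp add: some_in_eq)
  have sub: "C \<subseteq> D" if "C \<in> D // \<rho>" for C
    using in_quotient_imp_subset[OF equiv that] .
  have inj: "C = C'" if "C \<in> D // \<rho>" "C' \<in> D // \<rho>" "f C - f C' \<in> I" for C C'
  proof -
    have "(f C, f C') \<in> \<rho>"
      using that f sub by (auto simp: \<rho>_def)
    then show ?thesis
      using quotient_eqI[OF equiv that(1,2)] f that by blast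
  qed
  show ?thesis
  proof (rule that)
    show "f ` (D // \<rho>) \<subseteq> D"
      using f sub by blast
    show "\<exists>r\<in>f ` (D // \<rho>). x - r \<in> I" if "x \<in> D" for x
    proof -
      have "\<rho> `` {x} \<in> D // \<rho>"
        using that by (rule quotientI)
      then show ?thesis
        using f by (fastforce simp: \<rho>_def)
    qed
    show "r = s" if "r \<in> f ` (D // \<rho>)" "s \<in> f ` (D // \<rho>)" "r - s \<in> I" for r s
      using that inj by blast
    have "inj_on f (D // \<rho>)"
      by (rule inj_onI) (simp add: inj ideal_zero[OF I])
    then show "ideal_norm D I =
        (if finite (f ` (D // \<rho>)) then enat (card (f ` (D // \<rho>))) else \<infinity>)"
      unfolding ideal_norm_def residues_mod_def \<rho>_def[symmetric]
      by (simp add: finite_image_iff card_image)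
  qed
qed

text \<open>The comparison in \<open>enat\<close> also covers infinite norm. The elements serve as
  interpolation points when the norm is large, and as a full set of digits when it is small.\<close>

lemma incongruent_elements:
  assumes I: "ideal_of D I" and n: "enat n \<le> ideal_norm D I"
  obtains c where "\<And>i. i < n \<Longrightarrow> c i \<in> D" "\<And>i j. i < n \<Longrightarrow> j < n \<Longrightarrow> i \<noteq> j \<Longrightarrow> c i - c j \<notin> I"
proof -
  obtain R where R: "R \<subseteq> D" "\<And>r s. r \<in> R \<Longrightarrow> s \<in> R \<Longrightarrow> r - s \<in> I \<Longrightarrow> r = s"
    "ideal_norm D I = (if finite R then enat (card R) else \<infinity>)"
    using residue_transversal[OF I] by metis
  obtain T where T: "T \<subseteq> R" "card T = n" "finite T"
  proof (cases "finite R")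
    case True
    then show ?thesis
      using R(3) n obtain_subset_with_card_n[of n R] that by auto
  next
    case False
    then show ?thesis
      using infinite_arbitrarily_large[of R n] that by auto
  qed
  then obtain c where "bij_betw c {0..<n} T"
    using ex_bij_betw_nat_finite by blast
  then have "c i \<in> T" "c i \<noteq> c j" if "i < n" "j < n" "i \<noteq> j" for i j
    using that by (auto simp: bij_betw_def inj_on_def)
  moreover have "c i \<in> T" if "i < n" for i
    using that \<open>bij_betw c {0..<n} T\<close> by (auto simp: bij_betw_def)
  ultimately show ?thesis
    using that[of c] R(1,2) T(1) by blast
qed

text \<open>As in Fermat's little theorem, multiplication by \<open>x\<close> permutes the nonzero
  residue classes. The product of their representatives lies outside the prime ideal
  \<open>P\<close>, so it cancels.\<close>

lemma fermat_t_maximal: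
  assumes P: "t_maximal D P" and q: "ideal_norm D P = enat q" and x: "x \<in> D - P"
  shows "x ^ (q - 1) - 1 \<in> P"
proof -
  have I: "ideal_of D P"
    using P by (rule t_maximal_ideal)
  obtain R where R: "R \<subseteq> D" "\<And>x. x \<in> D \<Longrightarrow> \<exists>r\<in>R. x - r \<in> P"
    "\<And>r s. r \<in> R \<Longrightarrow> s \<in> R \<Longrightarrow> r - s \<in> P \<Longrightarrow> r = s"
    "ideal_norm D P = (if finite R then enat (card R) else \<infinity>)"
    using residue_transversal[OF I] by metis
  then have finR: "finite R" and cardR: "card R = q"
    using q by (auto split: if_splits)
  \<comment> \<open>\<open>r0\<close> represents the class of \<open>0\<close>; the remaining
    representatives are exactly those outside \<open>P\<close>.\<close>
  obtain r0 where r0: "r0 \<in> R" "r0 \<in> P"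
    using R(2)[of 0] ideal_uminus[OF I] by fastforce
  have "R \<inter> P = {r0}"
    using r0 R(3) ideal_diff[OF I] by blast
  then have "R - P = R - {r0}"
    by blast
  then have card: "card (R - P) = q - 1"
    using finR cardR r0 by simp
  have "\<exists>s\<in>R. x * r - s \<in> P" if "r \<in> R" for r
    using that R(1) x by (intro R(2) mult_mem) auto
  then obtain \<phi> where \<phi>: "\<And>r. r \<in> R \<Longrightarrow> \<phi> r \<in> R \<and> x * r - \<phi> r \<in> P"
    by metis
  have "\<phi> r \<in> R - P" if "r \<in> R - P" for r
  proof -
    have "\<phi> r \<notin> P"
    proof
      assume "\<phi> r \<in> P"
      then have "x * r \<in> P"
        using \<phi>[of r] that ideal_add[OF I, of "x * r - \<phi> r" "\<phi> r"] by simp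
      then show False
        using t_maximal_mult_notin[OF P x, of r] that R(1) by blast
    qed
    then show ?thesis
      using \<phi> that by blast
  qed
  moreover have inj: "inj_on \<phi> (R - P)"
  proof (rule inj_onI)
    fix r s
    assume rs: "r \<in> R - P" "s \<in> R - P" "\<phi> r = \<phi> s"
    then have "x * r - \<phi> r \<in> P" "x * s - \<phi> r \<in> P"
      using \<phi>[of r] \<phi>[of s] by auto
    then have "x * r - x * s \<in> P"
      using ideal_cong_sym[OF I] ideal_cong_trans[OF I] by metis
    then have "x * (r - s) \<in> P"
      by (simp add: algebra_simps)
    then have "r - s \<in> P"
      using t_maximal_prime[OF P, of x "r - s"] x rs R(1) diff_mem by blast
    then show "r = s"
      using R(3) rs by blast
  qed
  ultimately have "\<phi> ` (R - P) = R - P"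
    using finR by (intro endo_inj_surj) auto
  then have "(\<Prod>r\<in>R - P. \<phi> r) = \<Prod>(R - P)"
    using prod.reindex[OF inj, of "\<lambda>r. r"] by simp
  moreover have "(\<Prod>r\<in>R - P. x * r) - (\<Prod>r\<in>R - P. \<phi> r) \<in> P"
    using I finR \<phi> R(1) x by (intro ideal_cong_prod) (auto intro: mult_mem)
  ultimately have "\<Prod>(R - P) * (x ^ (q - 1) - 1) \<in> P"
    by (simp add: prod.distrib card algebra_simps)
  moreover have "\<Prod>(R - P) \<in> D - P"
    using P R(1) by (intro t_maximal_prod_notin) auto
  moreover have "x ^ (q - 1) - 1 \<in> D"
    using x by (intro diff_mem power_mem) auto
  ultimately show ?thesis
    using t_maximal_prime[OF P, of "\<Prod>(R - P)"] by blast
qed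

text \<open>Since \<open>1\<close> is not in \<open>P\<close>, the classes of \<open>0\<close> and
  \<open>1\<close> differ. The bound keeps the subtractions \<open>q - 1\<close> and
  \<open>q - 2\<close> exact and makes \<open>q\<close> a valid base for digit expansions.\<close>

lemma ideal_norm_ge_2:
  assumes P: "t_maximal D P"
  shows "enat 2 \<le> ideal_norm D P"
proof -
  have I: "ideal_of D P"
    using P by (rule t_maximal_ideal)
  obtain R where R: "R \<subseteq> D" "\<And>x. x \<in> D \<Longrightarrow> \<exists>r\<in>R. x - r \<in> P"
    "ideal_norm D P = (if finite R then enat (card R) else \<infinity>)"
    using residue_transversal[OF I] by metis
  obtain r s where rs: "r \<in> R" "s \<in> R" "0 - r \<in> P" "1 - s \<in> P"
    using R(2)[of 0] R(2)[of 1] by auto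
  have "r \<noteq> s"
    using rs t_maximal_one_notin[OF P] ideal_diff[OF I rs(4,3)] by auto
  moreover have "card {r, s} \<le> card R" if "finite R"
    using rs that by (intro card_mono) auto
  ultimately show ?thesis
    using R(3) by auto
qed

text \<open>Outside \<open>P\<close> this is Fermat's congruence multiplied by \<open>x\<close>;
  inside \<open>P\<close> it is immediate.\<close>

lemma t_maximal_frobenius:
  assumes P: "t_maximal D P" and q: "ideal_norm D P = enat q" and x: "x \<in> D"
  shows "x ^ q - x \<in> P"
proof -
  have I: "ideal_of D P"
    using P by (rule t_maximal_ideal)
  have "2 \<le> q"
    using ideal_norm_ge_2[OF P] q by simp
  then have "x ^ q - x = x * (x ^ (q - 1) - 1)"
    by (cases q) (auto simp: algebra_simps)
  moreover have "x * (x ^ (q - 1) - 1) \<in> P"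
  proof (cases "x \<in> P")
    case True
    then show ?thesis
      using x by (intro ideal_mult_right[OF I] diff_mem power_mem one_mem)
  next
    case False
    then show ?thesis
      using x by (intro ideal_mult_left[OF I] fermat_t_maximal[OF P q]) auto
  qed
  ultimately show ?thesis
    by simp
qed

text \<open>Fermat's congruence exhibits the inverse as \<open>x ^ (q - 2)\<close>.\<close>

lemma t_maximal_inverse_mod:
  assumes P: "t_maximal D P" and q: "ideal_norm D P = enat q" and x: "x \<in> D - P"
  shows "\<exists>y\<in>D. 1 - y * x \<in> P"
proof
  have "2 \<le> q"
    using ideal_norm_ge_2[OF P] q by simp
  then have "x ^ (q - 1) = x ^ (q - 2) * x"
    by (metis Suc_1 Suc_diff_le diff_Suc_Suc power_Suc2)
  then show "1 - x ^ (q - 2) * x \<in> P"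
    using fermat_t_maximal[OF assms] ideal_cong_sym[OF t_maximal_ideal[OF P]] by metis
  show "x ^ (q - 2) \<in> D"
    using x power_mem by blast
qed

end


subsection \<open>Comaximal generators\<close>

context domain_in_field
begin

definition comaximal :: "'k \<Rightarrow> 'k \<Rightarrow> bool" where
  "comaximal x y \<longleftrightarrow> (\<exists>u\<in>D. \<exists>v\<in>D. u * x + v * y = 1)"

lemma comaximal_sym: "comaximal x y \<Longrightarrow> comaximal y x"
  unfolding comaximal_def by (metis add.commute)

lemma comaximal_1: "comaximal x 1"
  unfolding comaximal_def by (rule bexI[of _ 0], rule bexI[of _ 1]) auto

text \<open>In the product of the two Bezout identities every term except
  \<open>v * v' * (y * z)\<close> is a multiple of \<open>x\<close>.\<close>

lemma comaximal_mult:
  assumes "comaximal x y" "comaximal x z" "x \<in> D" "y \<in> D" "z \<in> D"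
  shows "comaximal x (y * z)"
proof -
  obtain u v u' v' where D: "u \<in> D" "v \<in> D" "u' \<in> D" "v' \<in> D"
    and eq: "u * x + v * y = 1" "u' * x + v' * z = 1"
    using assms(1,2) unfolding comaximal_def by auto
  have "1 = (u * x + v * y) * (u' * x + v' * z)"
    by (simp add: eq)
  also have "\<dots> = (u * u' * x + u * v' * z + v * y * u') * x + v * v' * (y * z)"
    by (simp add: algebra_simps)
  finally have "(u * u' * x + u * v' * z + v * y * u') * x + v * v' * (y * z) = 1" ..
  moreover have "u * u' * x + u * v' * z + v * y * u' \<in> D" "v * v' \<in> D"
    using D assms(3-5) by (auto intro!: add_mem mult_mem)
  ultimately show ?thesis
    unfolding comaximal_def by blast
qed

lemma comaximal_prod:
  "x \<in> D \<Longrightarrow> (\<And>i. i \<in> A \<Longrightarrow> comaximal x (f i) \<and> f i \<in> D) \<Longrightarrow> comaximal x (prod f A)"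
  by (induction A rule: infinite_finite_induct)
    (auto intro!: comaximal_1 comaximal_mult prod_mem)

lemma comaximal_power:
  "x \<in> D \<Longrightarrow> y \<in> D \<Longrightarrow> comaximal x y \<Longrightarrow> comaximal (x ^ m) (y ^ n)"
  using comaximal_prod[of x "{..<n}" "\<lambda>_. y"] comaximal_prod[of "y ^ n" "{..<m}" "\<lambda>_. x"]
  by (auto intro: comaximal_sym power_mem)

text \<open>A partition of unity, built by adding one element at a time: \<open>b m\<close> is
  comaximal to the product of the others. The empty set is excluded because its sum is
  \<open>0\<close>.\<close>

lemma comaximal_family:
  assumes "finite A" "A \<noteq> {}" "\<And>i. i \<in> A \<Longrightarrow> b i \<in> D"
    and "\<And>i j. i \<in> A \<Longrightarrow> j \<in> A \<Longrightarrow> i \<noteq> j \<Longrightarrow> comaximal (b i) (b j)"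
  shows "\<exists>a. (\<forall>i\<in>A. a i \<in> D) \<and> (\<Sum>i\<in>A. a i * prod b (A - {i})) = 1"
  using assms
proof (induction A rule: finite_ne_induct)
  case (singleton x)
  show ?case
    by (rule exI[of _ "\<lambda>_. 1"]) simp
next
  case (insert m A)
  have "\<exists>a. (\<forall>i\<in>A. a i \<in> D) \<and> (\<Sum>i\<in>A. a i * prod b (A - {i})) = 1"
    by (rule insert.IH) (simp_all add: insert.prems)
  then obtain a where a: "\<forall>i\<in>A. a i \<in> D" "(\<Sum>i\<in>A. a i * prod b (A - {i})) = 1"
    by blast
  have "comaximal (b m) (prod b A)"
    by (rule comaximal_prod) (use insert.hyps insert.prems in auto)
  then obtain u v where uv: "u \<in> D" "v \<in> D" "u * b m + v * prod b A = 1"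
    unfolding comaximal_def by blast
  \<comment> \<open>In \<open>u * b m + v * prod b A = 1\<close> the first term is multiplied by the
    old combination, which equals \<open>1\<close>; the second becomes the summand for
    \<open>m\<close>.\<close>
  define a' where "a' i = (if i = m then v else u * a i)" for i
  have "prod b (insert m A - {i}) = b m * prod b (A - {i})" if "i \<in> A" for i
  proof -
    have "insert m A - {i} = insert m (A - {i})"
      using that insert.hyps by auto
    then show ?thesis
      using insert.hyps by simp
  qed
  then have "(\<Sum>i\<in>A. a' i * prod b (insert m A - {i})) =
      (\<Sum>i\<in>A. u * b m * (a i * prod b (A - {i})))"
    using insert.hyps by (intro sum.cong) (auto simp: a'_def)
  moreover have "insert m A - {m} = A"
    using insert.hyps by auto
  ultimately have "(\<Sum>i\<in>insert m A. a' i * prod b (insert m A - {i})) =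
      v * prod b A + (\<Sum>i\<in>A. u * b m * (a i * prod b (A - {i})))"
    using insert.hyps by (simp add: a'_def)
  also have "\<dots> = 1"
    using uv(3) by (simp add: sum_distrib_left[symmetric] a(2) add.commute)
  finally have "(\<Sum>i\<in>insert m A. a' i * prod b (insert m A - {i})) = 1" .
  moreover have "\<forall>i\<in>insert m A. a' i \<in> D"
    using uv a(1) by (auto simp: a'_def intro: mult_mem)
  ultimately show ?case
    by blast
qed

lemma ideal_cyclic_module: "x \<in> D \<Longrightarrow> ideal_of D (cyclic_module D x)"
  unfolding ideal_of_def cyclic_module_def
  by (auto simp: image_iff distrib_right[symmetric] mult.assoc[symmetric] intro: mem_intros)

lemma int_valued_diff: "f \<in> int_valued D \<Longrightarrow> g \<in> int_valued D \<Longrightarrow> f - g \<in> int_valued D"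
  and int_valued_smult: "d \<in> D \<Longrightarrow> f \<in> int_valued D \<Longrightarrow> smult d f \<in> int_valued D"
  and int_valued_pcompose:
    "f \<in> int_valued D \<Longrightarrow> g \<in> int_valued D \<Longrightarrow> pcompose f g \<in> int_valued D"
  and int_valued_X: "[:0, 1:] \<in> int_valued D"
  and int_valued_1: "1 \<in> int_valued D"
  by (auto simp: int_valued_def poly_pcompose intro: mem_intros)

lemma int_valued_sum: "(\<And>i. i \<in> A \<Longrightarrow> f i \<in> int_valued D) \<Longrightarrow> sum f A \<in> int_valued D"
  by (auto simp: int_valued_def poly_sum intro: sum_mem)

lemma int_valued_prod: "(\<And>i. i \<in> A \<Longrightarrow> f i \<in> int_valued D) \<Longrightarrow> prod f A \<in> int_valued D"
  by (auto simp: int_valued_def poly_prod intro: prod_mem)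

lemma int_valued_power: "f \<in> int_valued D \<Longrightarrow> f ^ n \<in> int_valued D"
  by (auto simp: int_valued_def intro: power_mem)

end

section \<open>Generators of the ideals \<open>Pi_ideal D n\<close>\<close>

locale norm_ideal_generators = domain_in_field D for D :: "'k::field set" +
  fixes \<pi> :: "nat \<Rightarrow> 'k"
  assumes finite_t_maximal: "finite {P. t_maximal D P \<and> ideal_norm D P \<le> enat n}"
    and pi_generator: "\<pi> n \<in> D \<and> Pi_ideal D n = cyclic_module D (\<pi> n)"
begin

abbreviation t_maximal_norm :: "nat \<Rightarrow> 'k set set" where
  "t_maximal_norm n \<equiv> {P. t_maximal D P \<and> ideal_norm D P = enat n}"

lemma finite_t_maximal_norm: "finite (t_maximal_norm n)"
  by (rule finite_subset[OF _ finite_t_maximal[of n]]) auto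

lemma pi_mem: "\<pi> n \<in> D"
  using pi_generator by blast

text \<open>The generator property as divisibility. If no \<open>t\<close>-maximal ideal has norm
  \<open>n\<close>, the condition on \<open>P\<close> is vacuous and \<open>\<pi> n\<close> divides
  every element of \<open>D\<close>.\<close>

lemma pi_dvd:
  assumes "x \<in> D" "\<And>P. P \<in> t_maximal_norm n \<Longrightarrow> x \<in> P"
  shows "\<exists>d\<in>D. x = d * \<pi> n"
proof -
  have "x \<in> Pi_ideal D n"
    using assms by (auto simp: Pi_ideal_def)
  then show ?thesis
    using pi_generator by (auto simp: cyclic_module_def)
qed

lemma pi_in_t_maximal:
  assumes "t_maximal D P" "ideal_norm D P = enat n"
  shows "\<pi> n \<in> P"
proof -
  have "\<pi> n \<in> cyclic_module D (\<pi> n)"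
    unfolding cyclic_module_def by (rule image_eqI[of _ _ 1]) auto
  then show ?thesis
    using assms pi_generator[of n] by (auto simp: Pi_ideal_def)
qed

text \<open>Picking a nonzero element from each of the finitely many ideals of norm \<open>n\<close>
  and multiplying gives a nonzero multiple of \<open>\<pi> n\<close>.\<close>

lemma pi_nonzero: "\<pi> n \<noteq> 0"
proof -
  have "\<exists>x. x \<in> P \<and> x \<noteq> 0" if "P \<in> t_maximal_norm n" for P
    using that unfolding t_maximal_def proper_t_ideal_def ideal_of_def by blast
  then obtain g where g: "\<And>P. P \<in> t_maximal_norm n \<Longrightarrow> g P \<in> P \<and> g P \<noteq> 0"
    by metis
  have mem: "g P \<in> D" if "P \<in> t_maximal_norm n" for P
    using that g ideal_subset t_maximal_ideal by blast
  have "prod g (t_maximal_norm n) \<in> P" if "P \<in> t_maximal_norm n" for P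
    using that g mem finite_t_maximal_norm
    by (intro ideal_prod[of P _ P]) (auto intro: t_maximal_ideal)
  then have "\<exists>d\<in>D. prod g (t_maximal_norm n) = d * \<pi> n"
    by (intro pi_dvd prod_mem mem) auto
  then obtain d where "prod g (t_maximal_norm n) = d * \<pi> n"
    by blast
  moreover have "prod g (t_maximal_norm n) \<noteq> 0"
    using g finite_t_maximal_norm by simp
  ultimately show ?thesis
    by auto
qed

text \<open>Distinct \<open>t\<close>-maximal ideals are incomparable, so each ideal of norm
  \<open>n\<close> has an element outside \<open>P\<close>. Their product is a multiple of
  \<open>\<pi> n\<close>, yet outside \<open>P\<close> by primality.\<close>

lemma pi_notin_t_maximal:
  assumes P: "t_maximal D P" and norm: "ideal_norm D P \<noteq> enat n"
  shows "\<pi> n \<notin> P"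
proof
  assume "\<pi> n \<in> P"
  have "\<exists>x. x \<in> Q \<and> x \<notin> P" if "Q \<in> t_maximal_norm n" for Q
    using that assms t_maximal_subset_eq[of Q P] by blast
  then obtain g where g: "\<And>Q. Q \<in> t_maximal_norm n \<Longrightarrow> g Q \<in> Q \<and> g Q \<notin> P"
    by metis
  have mem: "g Q \<in> D" if "Q \<in> t_maximal_norm n" for Q
    using that g ideal_subset t_maximal_ideal by blast
  have "prod g (t_maximal_norm n) \<in> Q" if "Q \<in> t_maximal_norm n" for Q
    using that g mem finite_t_maximal_norm
    by (intro ideal_prod[of Q _ Q]) (auto intro: t_maximal_ideal)
  then have "\<exists>d\<in>D. prod g (t_maximal_norm n) = d * \<pi> n"
    by (intro pi_dvd prod_mem mem) auto
  then obtain d where "d \<in> D" "prod g (t_maximal_norm n) = d * \<pi> n"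
    by blast
  then have "prod g (t_maximal_norm n) \<in> P"
    using \<open>\<pi> n \<in> P\<close> ideal_mult_left[OF t_maximal_ideal[OF P]] by simp
  moreover have "prod g (t_maximal_norm n) \<in> D - P"
    using P g mem by (intro t_maximal_prod_notin) auto
  ultimately show False
    by blast
qed

text \<open>Modulo each \<open>P\<close> of norm \<open>j\<close>, \<open>\<pi> k\<close> has an
  inverse \<open>y P\<close>. The product of all \<open>1 - y P * \<pi> k\<close> is a multiple of
  \<open>\<pi> j\<close> and congruent to \<open>1\<close> modulo \<open>\<pi> k\<close>.\<close>

lemma comaximal_pi:
  assumes "j \<noteq> k"
  shows "comaximal (\<pi> j) (\<pi> k)"
proof -
  have "\<exists>y\<in>D. 1 - y * \<pi> k \<in> P" if "P \<in> t_maximal_norm j" for P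
    using that assms pi_mem by (intro t_maximal_inverse_mod) (auto simp: pi_notin_t_maximal)
  then obtain y where y: "\<And>P. P \<in> t_maximal_norm j \<Longrightarrow> y P \<in> D \<and> 1 - y P * \<pi> k \<in> P"
    by metis
  let ?f = "\<lambda>P. 1 - y P * \<pi> k"
  have mem: "?f P \<in> D" if "P \<in> t_maximal_norm j" for P
    using that y pi_mem by (intro diff_mem mult_mem) auto
  have "prod ?f (t_maximal_norm j) \<in> P" if "P \<in> t_maximal_norm j" for P
    using that y mem finite_t_maximal_norm
    by (intro ideal_prod[of P _ P]) (auto intro: t_maximal_ideal)
  then have "\<exists>d\<in>D. prod ?f (t_maximal_norm j) = d * \<pi> j"
    by (intro pi_dvd prod_mem mem) auto
  then obtain d where d: "d \<in> D" "prod ?f (t_maximal_norm j) = d * \<pi> j"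
    by blast
  have "?f P - 1 \<in> cyclic_module D (\<pi> k)" if "P \<in> t_maximal_norm j" for P
    unfolding cyclic_module_def
    using that y by (intro image_eqI[of _ _ "- y P"]) (auto intro: uminus_mem)
  then have "prod ?f (t_maximal_norm j) - (\<Prod>P\<in>t_maximal_norm j. 1) \<in> cyclic_module D (\<pi> k)"
    using mem pi_mem finite_t_maximal_norm
    by (intro ideal_cong_prod ideal_cyclic_module) auto
  then obtain e where "e \<in> D" "d * \<pi> j - 1 = e * \<pi> k"
    using d(2) by (auto simp: cyclic_module_def)
  then show ?thesis
    using d(1) unfolding comaximal_def
    by (intro bexI[of _ d] bexI[of _ "- e"]) (auto simp: algebra_simps intro: uminus_mem)
qed

lemma sigma_nonzero: "sigma \<pi> n \<noteq> 0"
  by (simp add: sigma_def pi_nonzero power_int_minus)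

lemma inverse_sigma: "inverse (sigma \<pi> n) = (\<Prod>k\<in>{1<..n}. \<pi> k ^ w k n)"
  by (simp add: sigma_def power_int_minus prod_inversef[symmetric] flip: comp_def)

lemma sigma_mult_prod_minus:
  assumes "k \<in> {1<..n}"
  shows "sigma \<pi> n * (\<Prod>j\<in>{1<..n} - {k}. \<pi> j ^ w j n) = \<pi> k powi - int (w k n)"
proof -
  have "inverse (sigma \<pi> n) = \<pi> k ^ w k n * (\<Prod>j\<in>{1<..n} - {k}. \<pi> j ^ w j n)"
    unfolding inverse_sigma using assms by (simp add: prod.remove)
  then have "sigma \<pi> n * (\<pi> k ^ w k n * (\<Prod>j\<in>{1<..n} - {k}. \<pi> j ^ w j n)) = 1"
    using sigma_nonzero[of n] by (metis right_inverse)
  then show ?thesis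
    using pi_nonzero[of k] by (simp add: power_int_minus field_simps)
qed

text \<open>The partition of unity for the powers \<open>\<pi> k ^ w k n\<close>, multiplied by
  \<open>sigma \<pi> n\<close>. For \<open>n > 1\<close> the index set is nonempty.\<close>

lemma sigma_combination:
  assumes "n > 1"
  shows "\<exists>a. (\<forall>k\<in>{1<..n}. a k \<in> D) \<and>
    sigma \<pi> n = (\<Sum>k\<in>{1<..n}. a k * \<pi> k powi - int (w k n))"
proof -
  obtain a where a: "\<forall>k\<in>{1<..n}. a k \<in> D"
    "(\<Sum>k\<in>{1<..n}. a k * (\<Prod>j\<in>{1<..n} - {k}. \<pi> j ^ w j n)) = 1"
    using comaximal_family[of "{1<..n}" "\<lambda>k. \<pi> k ^ w k n"] assms
    by (auto simp: pi_mem power_mem comaximal_pi comaximal_power)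
  have "sigma \<pi> n = sigma \<pi> n * (\<Sum>k\<in>{1<..n}. a k * (\<Prod>j\<in>{1<..n} - {k}. \<pi> j ^ w j n))"
    using a(2) by simp
  also have "\<dots> = (\<Sum>k\<in>{1<..n}. a k * (sigma \<pi> n * (\<Prod>j\<in>{1<..n} - {k}. \<pi> j ^ w j n)))"
    by (simp add: sum_distrib_left mult_ac)
  also have "\<dots> = (\<Sum>k\<in>{1<..n}. a k * \<pi> k powi - int (w k n))"
    by (intro sum.cong refl) (simp only: sigma_mult_prod_minus)
  finally show ?thesis
    using a(1) by blast
qed

text \<open>The Frobenius congruence puts \<open>x ^ n - x\<close> into every
  \<open>t\<close>-maximal ideal of norm \<open>n\<close>, so \<open>\<pi> n\<close> divides
  it.\<close>

lemma F_poly_int_valued: "F_poly \<pi> n \<in> int_valued D"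
  unfolding int_valued_def
proof (intro CollectI ballI)
  fix x
  assume x: "x \<in> D"
  then have "x ^ n - x \<in> D"
    by (intro diff_mem power_mem)
  moreover have "x ^ n - x \<in> P" if "P \<in> t_maximal_norm n" for P
    using that x t_maximal_frobenius by blast
  ultimately obtain d where "d \<in> D" "x ^ n - x = d * \<pi> n"
    using pi_dvd by blast
  then show "poly (F_poly \<pi> n) x \<in> D"
    using pi_nonzero[of n] by (simp add: F_poly_def poly_monom field_simps)
qed

end


subsection \<open>Degrees and \<open>k\<close>-adic digits\<close>

text \<open>For \<open>n < k ^ L\<close> this adds up the degrees of the factors of
  \<open>F_digit_poly\<close>.\<close>

lemma sum_digits:
  "(\<Sum>i<L. n div k ^ i mod k * k ^ i) = n mod k ^ L" for n k L :: nat
proof (induction L)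
  case (Suc L)
  have "n mod k ^ Suc L = k ^ L * (n div k ^ L mod k) + n mod k ^ L"
    using mod_mult2_eq[of n "k ^ L" k] by (simp add: mult.commute)
  then show ?case
    using Suc by (simp add: mult.commute)
qed simp

text \<open>Legendre's digit formula without division, for the exponents in the leading coefficient
  of \<open>F_digit_poly\<close>. The term with \<open>n div k ^ L\<close> carries the induction and
  vanishes once \<open>n < k ^ L\<close>.\<close>

lemma sum_digits_geometric:
  "(\<Sum>i<L. n div k ^ i mod k * (\<Sum>m<i. k ^ m)) + (\<Sum>m<L. k ^ m) * (n div k ^ L) =
    (\<Sum>i<L. n div k ^ Suc i)" for n k L :: nat
proof (induction L)
  case (Suc L)
  define a d where "a = n div k ^ Suc L" and "d = n div k ^ L mod k"
  have split: "n div k ^ L = k * a + d"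
    by (simp add: a_def d_def div_mult2_eq mult.commute[of k "k ^ L"])
  have geo: "(\<Sum>m<Suc L. k ^ m) = 1 + k * (\<Sum>m<L. k ^ m)"
    unfolding sum.lessThan_Suc_shift power_Suc by (simp add: sum_distrib_left)
  have "(\<Sum>m<Suc L. k ^ m) * a + d * (\<Sum>m<L. k ^ m) = (\<Sum>m<L. k ^ m) * (n div k ^ L) + a"
    unfolding geo split by (simp add: algebra_simps)
  then show ?case
    using Suc unfolding sum.lessThan_Suc[of _ L] a_def d_def by linarith
qed simp

lemma w_eq_sum:
  assumes "k > 1" "n < k ^ L"
  shows "w k n = (\<Sum>i<L. n div k ^ Suc i)"
  unfolding w_def
proof (rule suminf_finite)
  fix i
  assume "i \<notin> {..<L}"
  then have "k ^ L \<le> k ^ Suc i"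
    using assms(1) by (intro power_increasing) auto
  then show "n div k ^ Suc i = 0"
    using assms(2) by (intro div_less) linarith
qed simp

text \<open>\<open>L\<close> is the number of \<open>k\<close>-adic digits of \<open>n\<close>, with
  \<open>L = 0\<close> for \<open>n = 0\<close>.\<close>

lemma power_le_atMost:
  assumes "k > (1::nat)"
  obtains L where "n < k ^ L" "{i. k ^ i \<le> n} = {..<L}"
proof -
  define L where "L = (LEAST i. n < k ^ i)"
  have "n < k ^ n"
    using assms by (intro power_gt_expt) simp
  then have L: "n < k ^ L"
    unfolding L_def by (rule LeastI)
  have "k ^ i \<le> n \<longleftrightarrow> i < L" for i
  proof
    assume "k ^ i \<le> n"
    then have "k ^ i < k ^ L"
      using L by linarith
    then show "i < L"
      using assms by (simp add: power_strict_increasing_iff)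
  next
    assume "i < L"
    then show "k ^ i \<le> n"
      using not_less_Least[of i "\<lambda>i. n < k ^ i"] by (simp add: L_def)
  qed
  then show ?thesis
    using L that by auto
qed

lemma iter_comp_0: "iter_comp f 0 = [:0, 1:]"
  and iter_comp_Suc: "iter_comp f (Suc i) = pcompose f (iter_comp f i)"
  by (simp_all add: iter_comp_def)

lemma degree_iter_comp: "degree (iter_comp f i) = degree f ^ i"
  by (induction i) (simp_all add: iter_comp_0 iter_comp_Suc degree_pcompose)

text \<open>Each further composition raises the leading coefficient to the power
  \<open>degree f\<close> and contributes one more factor, so the exponents form a geometric sum.
  Positive degree keeps the inner polynomial nonconstant.\<close>

lemma lead_coeff_iter_comp:
  assumes "degree f > 0"
  shows "lead_coeff (iter_comp f i) = lead_coeff f ^ (\<Sum>m<i. degree f ^ m)"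
proof (induction i)
  case (Suc i)
  have "degree (iter_comp f i) > 0"
    using assms by (simp add: degree_iter_comp)
  then have "lead_coeff (iter_comp f (Suc i)) = lead_coeff f * lead_coeff (iter_comp f i) ^ degree f"
    unfolding iter_comp_Suc by (rule lead_coeff_comp)
  also have "\<dots> = lead_coeff f ^ (1 + (\<Sum>m<i. degree f ^ m) * degree f)"
    by (simp add: Suc power_mult)
  also have "1 + (\<Sum>m<i. degree f ^ m) * degree f = (\<Sum>m<Suc i. degree f ^ m)"
    unfolding sum.lessThan_Suc_shift power_Suc by (simp add: sum_distrib_left sum_distrib_right mult.commute)
  finally show ?case .
qed (simp add: iter_comp_0)


subsection \<open>Divided differences\<close>

lemma monic_prod_linear:
  fixes u :: "'i \<Rightarrow> 'a::idom"
  shows "degree (\<Prod>i\<in>A. [:- u i, 1:]) = card A" "coeff (\<Prod>i\<in>A. [:- u i, 1:]) (card A) = 1"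
proof -
  show deg: "degree (\<Prod>i\<in>A. [:- u i, 1:]) = card A"
    by (subst degree_prod_sum_eq) auto
  show "coeff (\<Prod>i\<in>A. [:- u i, 1:]) (card A) = 1"
    using lead_coeff_prod[of "\<lambda>i. [:- u i, 1:]" A] by (simp add: deg)
qed

text \<open>Lagrange interpolation at \<open>n + 1\<close> points, read off at the coefficient of \<open>X\<^sup>n\<close>.\<close>

lemma coeff_eq_divided_difference:
  fixes f :: "'a::field poly"
  assumes deg: "degree f \<le> n" and inj: "inj_on u {..n}"
  shows "coeff f n = (\<Sum>j\<le>n. poly f (u j) / (\<Prod>i\<in>{..n} - {j}. u j - u i))"
proof -
  define L where "L j = (\<Prod>i\<in>{..n} - {j}. [:- u i, 1:])" for j
  define \<Delta> where "\<Delta> j = (\<Prod>i\<in>{..n} - {j}. u j - u i)" for j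
  define g where "g = (\<Sum>j\<le>n. smult (poly f (u j) / \<Delta> j) (L j))"
  have L: "degree (L j) = n" "coeff (L j) n = 1" if "j \<le> n" for j
    using monic_prod_linear[of u "{..n} - {j}"] that by (auto simp: L_def)
  have \<Delta>: "\<Delta> j \<noteq> 0" if "j \<le> n" for j
    using inj that by (auto simp: \<Delta>_def inj_on_def)
  \<comment> \<open>Both polynomials have degree at most \<open>n\<close> and agree at
    \<open>n + 1\<close> distinct points.\<close>
  have "f = g"
  proof (rule poly_eqI_degree)
    show "poly f x = poly g x" if x: "x \<in> u ` {..n}" for x
    proof -
      obtain k where k: "k \<le> n" "x = u k"
        using x by blast
      have "poly (L j) x = (if j = k then \<Delta> k else 0)" if "j \<le> n" for j
        using k by (auto simp: L_def \<Delta>_def poly_prod)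
      then have "poly g x = (\<Sum>j\<le>n. if j = k then poly f (u k) else 0)"
        unfolding g_def poly_sum poly_smult by (intro sum.cong) (use \<Delta> in auto)
      then show ?thesis
        using k by simp
    qed
    have "degree g \<le> n"
      unfolding g_def by (intro degree_sum_le) (auto intro: order_trans[OF degree_smult_le] simp: L)
    then show "degree g < card (u ` {..n})" "degree f < card (u ` {..n})"
      using deg by (simp_all add: card_image[OF inj])
  qed
  then have "coeff f n = coeff g n"
    by simp
  also have "\<dots> = (\<Sum>j\<le>n. poly f (u j) / \<Delta> j)"
    unfolding g_def coeff_sum by (intro sum.cong) (simp_all add: L)
  finally show ?thesis
    by (simp add: \<Delta>_def)
qed

text \<open>The \<open>L\<close> lowest \<open>q\<close>-adic digits of \<open>i\<close>, with \<open>q\<close> replaced by \<open>t\<close> and each digit by its image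
  under \<open>c\<close>.\<close>

primrec digit_transfer :: "nat \<Rightarrow> (nat \<Rightarrow> 'a::comm_ring_1) \<Rightarrow> 'a \<Rightarrow> nat \<Rightarrow> nat \<Rightarrow> 'a" where
  "digit_transfer q c t 0 i = 0"
| "digit_transfer q c t (Suc L) i = c (i mod q) + t * digit_transfer q c t L (i div q)"

text \<open>An \<open>i\<close> in the given class is determined by \<open>i div d\<close>, which
  ranges over \<open>0\<close> to \<open>n div d\<close>. Excluding \<open>j\<close> removes the
  value \<open>j div d\<close> and so saves one.\<close>

lemma card_congruent_le:
  assumes "d > (0::nat)" "j \<le> n"
  shows "card {i \<in> {..n} - {j}. i mod d = j mod d} \<le> n div d"
proof -
  let ?A = "{i \<in> {..n} - {j}. i mod d = j mod d}"
  have inj: "i = i'" if "i mod d = i' mod d" "i div d = i' div d" for i i'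
    using that by (metis mult_div_mod_eq)
  then have "inj_on (\<lambda>i. i div d) ?A"
    by (auto intro!: inj_onI)
  moreover have "(\<lambda>i. i div d) ` ?A \<subseteq> {..n div d} - {j div d}"
    using inj by (auto intro: div_le_mono)
  ultimately have "card ?A \<le> card ({..n div d} - {j div d})"
    by (intro card_inj_on_le[of "\<lambda>i. i div d"]) auto
  also have "\<dots> = n div d"
    using assms(2) by (simp add: div_le_mono)
  finally show ?thesis .
qed

context domain_in_field
begin

lemma digit_transfer_mem:
  assumes "q > 0" "\<And>i. i < q \<Longrightarrow> c i \<in> D" "t \<in> D"
  shows "digit_transfer q c t L i \<in> D"
  by (induction L arbitrary: i) (use assms in \<open>auto intro!: add_mem mult_mem\<close>)

text \<open>If the lowest digits differ, the difference is nonzero modulo \<open>P\<close>; if they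
  agree, a factor \<open>t\<close> splits off and the quotients by \<open>q\<close> remain. The
  exponent is that of the largest power of \<open>q\<close> dividing \<open>i - j\<close>.\<close>

lemma digit_transfer_diff:
  assumes P: "t_maximal D P" and q: "q > 0" and t: "t \<in> P"
    and c: "\<And>i. i < q \<Longrightarrow> c i \<in> D" "\<And>i j. i < q \<Longrightarrow> j < q \<Longrightarrow> i \<noteq> j \<Longrightarrow> c i - c j \<notin> P"
    and ij: "i < q ^ L" "j < q ^ L" "i \<noteq> j"
  shows "\<exists>s\<in>D - P. digit_transfer q c t L i - digit_transfer q c t L j =
    s * t ^ (\<Sum>l<L. of_bool (i mod q ^ Suc l = j mod q ^ Suc l))"
  using ij
proof (induction L arbitrary: i j)
  case (Suc L)
  let ?u = "digit_transfer q c t"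
  have I: "ideal_of D P"
    using P by (rule t_maximal_ideal)
  have "t \<in> D"
    using I t ideal_subset by blast
  have mem: "?u L x \<in> D" for x
    using q c(1) \<open>t \<in> D\<close> by (rule digit_transfer_mem)
  \<comment> \<open>With equal lowest digits, congruence modulo \<open>q ^ (l + 2)\<close> reduces
    to congruence of the quotients modulo \<open>q ^ (l + 1)\<close>.\<close>
  have mod: "x mod q ^ Suc (Suc l) = q * (x div q mod q ^ Suc l) + x mod q" for x l
    using mod_mult2_eq[of x q "q ^ Suc l"] by simp
  show ?case
  proof (cases "i mod q = j mod q")
    case False
    have "i mod q ^ Suc l \<noteq> j mod q ^ Suc l" for l
    proof
      assume "i mod q ^ Suc l = j mod q ^ Suc l"
      then have "i mod q ^ Suc l mod q = j mod q ^ Suc l mod q"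
        by simp
      then show False
        using False by (simp add: mod_mod_cancel)
    qed
    then have exponent: "(\<Sum>l<Suc L. of_bool (i mod q ^ Suc l = j mod q ^ Suc l)) = (0::nat)"
      by simp
    let ?s = "?u (Suc L) i - ?u (Suc L) j"
    have s: "?s = (c (i mod q) - c (j mod q)) + t * (?u L (i div q) - ?u L (j div q))"
      by (simp add: algebra_simps)
    have "c (i mod q) - c (j mod q) = ?s - t * (?u L (i div q) - ?u L (j div q))"
      by (simp add: algebra_simps)
    moreover have "t * (?u L (i div q) - ?u L (j div q)) \<in> P"
      using t mem by (intro ideal_mult_right[OF I] diff_mem)
    moreover have "c (i mod q) - c (j mod q) \<notin> P"
      using q by (intro c(2) False) auto
    ultimately have "?s \<notin> P"
      using ideal_diff[OF I] by metis
    moreover have "?s \<in> D"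
      using q c(1) \<open>t \<in> D\<close> by (intro diff_mem digit_transfer_mem)
    ultimately show ?thesis
      unfolding exponent by (intro bexI[of _ ?s]) auto
  next
    case True
    have "i div q \<noteq> j div q"
      using True Suc.prems(3) by (metis mult_div_mod_eq)
    moreover have "i div q < q ^ L" "j div q < q ^ L"
      using Suc.prems(1,2) q by (simp_all add: less_mult_imp_div_less mult.commute)
    ultimately obtain s where s: "s \<in> D - P" "?u L (i div q) - ?u L (j div q) =
        s * t ^ (\<Sum>l<L. of_bool (i div q mod q ^ Suc l = j div q mod q ^ Suc l))"
      using Suc.IH by blast
    have "(\<Sum>l<Suc L. of_bool (i mod q ^ Suc l = j mod q ^ Suc l)) =
        Suc (\<Sum>l<L. of_bool (i mod q ^ Suc (Suc l) = j mod q ^ Suc (Suc l)))"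
      using True by (subst sum.lessThan_Suc_shift) simp
    also have "\<dots> = Suc (\<Sum>l<L. of_bool (i div q mod q ^ Suc l = j div q mod q ^ Suc l))"
      unfolding mod using True q by simp
    finally have exponent: "(\<Sum>l<Suc L. of_bool (i mod q ^ Suc l = j mod q ^ Suc l)) =
        Suc (\<Sum>l<L. of_bool (i div q mod q ^ Suc l = j div q mod q ^ Suc l))" .
    have "?u (Suc L) i - ?u (Suc L) j = t * (?u L (i div q) - ?u L (j div q))"
      using True by (simp add: algebra_simps)
    then show ?thesis
      unfolding exponent using s by (intro bexI[of _ s]) (simp_all add: mult_ac)
  qed
qed simp

text \<open>The transferred digits behave like a \<open>v\<close>-ordering.\<close>

lemma digit_transfer_denominator:
  assumes P: "t_maximal D P" and q: "q > 1" and t: "t \<in> P"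
    and c: "\<And>i. i < q \<Longrightarrow> c i \<in> D" "\<And>i j. i < q \<Longrightarrow> j < q \<Longrightarrow> i \<noteq> j \<Longrightarrow> c i - c j \<notin> P"
    and n: "n < q ^ L" and j: "j \<le> n"
  shows "\<exists>s\<in>D - P. \<exists>e\<le>w q n.
    (\<Prod>i\<in>{..n} - {j}. digit_transfer q c t L j - digit_transfer q c t L i) = s * t ^ e"
proof -
  let ?u = "digit_transfer q c t L"
  let ?e = "\<lambda>i. \<Sum>l<L. of_bool (j mod q ^ Suc l = i mod q ^ Suc l)"
  have "\<exists>s\<in>D - P. ?u j - ?u i = s * t ^ ?e i" if "i \<in> {..n} - {j}" for i
    using that n j q by (intro digit_transfer_diff[OF P _ t c]) auto
  then obtain s where s: "\<And>i. i \<in> {..n} - {j} \<Longrightarrow> s i \<in> D - P \<and> ?u j - ?u i = s i * t ^ ?e i"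
    by metis
  have "(\<Prod>i\<in>{..n} - {j}. ?u j - ?u i) = (\<Prod>i\<in>{..n} - {j}. s i * t ^ ?e i)"
    using s by (intro prod.cong) auto
  also have "\<dots> = prod s ({..n} - {j}) * t ^ (\<Sum>i\<in>{..n} - {j}. ?e i)"
    by (simp add: prod.distrib power_sum)
  finally have eq: "(\<Prod>i\<in>{..n} - {j}. ?u j - ?u i) =
    prod s ({..n} - {j}) * t ^ (\<Sum>i\<in>{..n} - {j}. ?e i)" .
  \<comment> \<open>Double counting: for each \<open>l\<close> the indices congruent to
    \<open>j\<close> modulo \<open>q ^ Suc l\<close> are counted.\<close>
  have "(\<Sum>i\<in>{..n} - {j}. ?e i) = (\<Sum>l<L. \<Sum>i\<in>{..n} - {j}. of_bool (j mod q ^ Suc l = i mod q ^ Suc l))"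
    by (rule sum.swap)
  also have "\<dots> = (\<Sum>l<L. card {i \<in> {..n} - {j}. i mod q ^ Suc l = j mod q ^ Suc l})"
    by (intro sum.cong refl) (simp add: sum_of_bool_eq Int_def eq_commute)
  also have "\<dots> \<le> (\<Sum>l<L. n div q ^ Suc l)"
    using q j by (intro sum_mono card_congruent_le) auto
  also have "\<dots> = w q n"
    using w_eq_sum[OF q n] ..
  finally have "(\<Sum>i\<in>{..n} - {j}. ?e i) \<le> w q n" .
  moreover have "prod s ({..n} - {j}) \<in> D - P"
    using P s by (intro t_maximal_prod_notin) auto
  ultimately show ?thesis
    using eq by blast
qed

end


subsection \<open>Characteristic ideals and regular bases\<close>

context domain_in_field
begin

text \<open>Spanning follows by removing top coefficients successively, which \<open>char\<close>
  permits with multipliers in \<open>D\<close>. Independence follows from the distinct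
  degrees.\<close>

lemma regular_basisI:
  assumes G: "\<And>n. G n \<in> int_valued D" "\<And>n. degree (G n) = n" "\<And>n. lead_coeff (G n) \<noteq> 0"
    and char: "\<And>n. char_ideal D n \<subseteq> cyclic_module D (lead_coeff (G n))"
  shows "regular_basis D (range G)"
proof -
  have inj: "inj G"
    using G(2) by (metis injI)
  have expand: "\<exists>c. (\<forall>i\<le>n. c i \<in> D) \<and> f = (\<Sum>i\<le>n. smult (c i) (G i))"
    if "f \<in> int_valued D" "degree f \<le> n" for f n
    using that
  proof (induction n arbitrary: f)
    have reduce: "\<exists>d\<in>D. f - smult d (G n) \<in> int_valued D \<and> coeff (f - smult d (G n)) n = 0
        \<and> degree (f - smult d (G n)) \<le> n"
      if "f \<in> int_valued D" "degree f \<le> n" for f n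
    proof -
      have "coeff f n \<in> char_ideal D n"
        using that by (auto simp: char_ideal_def)
      then obtain d where d: "d \<in> D" "coeff f n = d * lead_coeff (G n)"
        using char by (force simp: cyclic_module_def)
      have "degree (f - smult d (G n)) \<le> n"
        using that(2) G(2)[of n] by (intro degree_diff_le) (auto intro: order_trans[OF degree_smult_le])
      then show ?thesis
        using d that(1) G(1,2)[of n] by (auto intro!: bexI[of _ d] int_valued_diff int_valued_smult)
    qed
    {
      case 0
      then obtain d where "d \<in> D" "coeff (f - smult d (G 0)) 0 = 0" "degree (f - smult d (G 0)) \<le> 0"
        using reduce by blast
      moreover from this have "f - smult d (G 0) = 0"
        by (metis leading_coeff_0_iff le_zero_eq)
      ultimately show ?case
        by (intro exI[of _ "\<lambda>_. d"]) auto
    next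
      case (Suc n)
      then obtain d where d: "d \<in> D" "f - smult d (G (Suc n)) \<in> int_valued D"
        "coeff (f - smult d (G (Suc n))) (Suc n) = 0" "degree (f - smult d (G (Suc n))) \<le> Suc n"
        using reduce by blast
      have "degree (f - smult d (G (Suc n))) \<le> n"
      proof (rule degree_le, intro allI impI)
        fix i
        assume "n < i"
        then show "coeff (f - smult d (G (Suc n))) i = 0"
          using d(3,4) by (cases "i = Suc n") (auto intro!: coeff_eq_0 simp del: coeff_diff)
      qed
      then obtain c where c: "\<forall>i\<le>n. c i \<in> D" "f - smult d (G (Suc n)) = (\<Sum>i\<le>n. smult (c i) (G i))"
        using Suc.IH d(2) by blast
      have "f = (f - smult d (G (Suc n))) + smult d (G (Suc n))"
        by simp
      also have "\<dots> = (\<Sum>i\<le>Suc n. smult ((c(Suc n := d)) i) (G i))"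
        unfolding c(2) by simp
      finally show ?case
        using c(1) d(1) by (intro exI[of _ "c(Suc n := d)"]) auto
    }
  qed
  have "span_over D smult (range G) = int_valued D"
  proof
    show "span_over D smult (range G) \<subseteq> int_valued D"
      using G(1) by (auto simp: span_over_def intro!: int_valued_sum int_valued_smult)
    show "int_valued D \<subseteq> span_over D smult (range G)"
    proof
      fix f
      assume "f \<in> int_valued D"
      then obtain c where c: "\<forall>i\<le>degree f. c i \<in> D" "f = (\<Sum>i\<le>degree f. smult (c i) (G i))"
        using expand[of f "degree f"] by blast
      \<comment> \<open>\<open>degree\<close> is a left inverse of \<open>G\<close>, so it turns
        coefficients indexed by degree into coefficients indexed by polynomials.\<close>
      have "f = (\<Sum>b\<in>G ` {..degree f}. smult (c (degree b)) b)"
        using inj by (subst sum.reindex) (auto intro: inj_on_subset simp: G(2) c(2)[symmetric])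
      then show "f \<in> span_over D smult (range G)"
        using c(1) G(2) unfolding span_over_def
        by (intro CollectI exI[of _ "G ` {..degree f}"] exI[of _ "\<lambda>b. c (degree b)"]) auto
    qed
  qed
  moreover have "\<forall>b\<in>F. c b = 0"
    if F: "finite F" "F \<subseteq> range G" and zero: "(\<Sum>b\<in>F. smult (c b) b) = 0" for F c
  proof (rule ccontr)
    assume "\<not> (\<forall>b\<in>F. c b = 0)"
    then have ne: "degree ` {b\<in>F. c b \<noteq> 0} \<noteq> {}"
      by auto
    \<comment> \<open>Exactly one term with a nonzero coefficient has the top degree
      \<open>m\<close>, so nothing cancels the coefficient there.\<close>
    define m where "m = Max (degree ` {b\<in>F. c b \<noteq> 0})"
    have "m \<in> degree ` {b\<in>F. c b \<noteq> 0}"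
      unfolding m_def using F(1) ne by (intro Max_in) auto
    then obtain b where b: "b \<in> F" "c b \<noteq> 0" "degree b = m"
      by auto
    have "coeff (smult (c b') b') m = 0" if "b' \<in> F - {b}" for b'
    proof (cases "c b' = 0")
      case False
      then have "degree b' \<le> m"
        unfolding m_def using that F(1) by (intro Max_ge) auto
      moreover have "degree b' \<noteq> m"
        using that b F(2) G(2) by (metis DiffD1 DiffD2 insertI1 rangeE subsetD)
      ultimately show ?thesis
        by (simp add: coeff_eq_0)
    qed simp
    then have "(\<Sum>b'\<in>F - {b}. coeff (smult (c b') b') m) = 0"
      by (rule sum.neutral[rule_format])
    then have "coeff (\<Sum>b\<in>F. smult (c b) b) m = c b * coeff b m"
      using F(1) b(1) by (simp add: coeff_sum sum.remove[of F b])
    moreover have "coeff b m \<noteq> 0"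
      using b(1,3) F(2) G(3) by auto
    ultimately show False
      using zero b(2) by simp
  qed
  moreover have "\<exists>!f. f \<in> range G \<and> degree f = n" for n
    using G(2) by (intro ex1I[of _ "G n"]) auto
  ultimately show ?thesis
    unfolding regular_basis_def module_basis_def by blast
qed

end

section \<open>The polynomials \<open>F_digit_poly\<close> and \<open>G_poly\<close>, and generators
  of the characteristic ideals\<close>

context norm_ideal_generators
begin

lemma degree_F_poly:
  assumes "k > 1"
  shows "degree (F_poly \<pi> k) = k" "lead_coeff (F_poly \<pi> k) = inverse (\<pi> k)"
proof -
  have "degree (- [:0, 1:] :: 'k poly) < degree (monom (1::'k) k)"
    using assms by (simp add: degree_monom_eq)
  from degree_add_eq_left[OF this] have "degree (monom (1::'k) k - [:0, 1:]) = k"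
    by (simp only: diff_conv_add_uminus[symmetric] degree_monom_eq one_neq_zero not_False_eq_True)
  then show deg: "degree (F_poly \<pi> k) = k"
    by (simp add: F_poly_def pi_nonzero)
  have "coeff [:0, 1:] k = (0::'k)"
    using assms by (intro coeff_eq_0) simp
  then show "lead_coeff (F_poly \<pi> k) = inverse (\<pi> k)"
    unfolding deg by (simp add: F_poly_def)
qed

lemma F_digit_poly_int_valued: "F_digit_poly \<pi> k n \<in> int_valued D"
proof -
  have "iter_comp (F_poly \<pi> k) i \<in> int_valued D" for i
    by (induction i)
      (simp_all add: iter_comp_0 iter_comp_Suc int_valued_X int_valued_pcompose F_poly_int_valued)
  then show ?thesis
    unfolding F_digit_poly_def by (intro int_valued_prod int_valued_power)
qed

text \<open>The \<open>i\<close>-th iterate has degree \<open>k ^ i\<close>, and its leading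
  coefficient has exponent \<open>1 + k + ... + k ^ (i - 1)\<close>. Weighted by the digits of
  \<open>n\<close>, these add up to \<open>n\<close> and \<open>w k n\<close>.\<close>

lemma F_digit_poly_degree:
  assumes "k > 1"
  shows "degree (F_digit_poly \<pi> k n) = n"
    and "lead_coeff (F_digit_poly \<pi> k n) = \<pi> k powi - int (w k n)"
proof -
  obtain L where L: "n < k ^ L" "{i. k ^ i \<le> n} = {..<L}"
    using power_le_atMost[OF assms] by blast
  let ?F = "\<lambda>i. iter_comp (F_poly \<pi> k) i"
  note F = degree_F_poly[OF assms]
  have "degree (F_poly \<pi> k) > 0"
    using assms by (simp add: F)
  then have lead: "lead_coeff (?F i) = inverse (\<pi> k) ^ (\<Sum>m<i. k ^ m)" for i
    by (metis F lead_coeff_iter_comp)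
  have "lead_coeff (?F i) \<noteq> 0" for i
    unfolding lead using pi_nonzero[of k] by simp
  then have "?F i \<noteq> 0" for i
    using leading_coeff_0_iff by blast
  then have "degree (F_digit_poly \<pi> k n) = (\<Sum>i<L. n div k ^ i mod k * k ^ i)"
    unfolding F_digit_poly_def L(2)
    by (subst degree_prod_sum_eq) (simp_all add: degree_power_eq degree_iter_comp F)
  then show "degree (F_digit_poly \<pi> k n) = n"
    using L(1) by (simp add: sum_digits)
  have "lead_coeff (F_digit_poly \<pi> k n) = (\<Prod>i<L. (inverse (\<pi> k) ^ (\<Sum>m<i. k ^ m)) ^ (n div k ^ i mod k))"
    unfolding F_digit_poly_def L(2) lead_coeff_prod lead_coeff_power lead ..
  also have "\<dots> = inverse (\<pi> k) ^ (\<Sum>i<L. n div k ^ i mod k * (\<Sum>m<i. k ^ m))"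
    by (subst power_sum) (simp flip: power_mult add: mult.commute)
  also have "(\<Sum>i<L. n div k ^ i mod k * (\<Sum>m<i. k ^ m)) = w k n"
    using sum_digits_geometric[of n k L] L(1) by (simp add: w_eq_sum[OF assms L(1)])
  finally show "lead_coeff (F_digit_poly \<pi> k n) = \<pi> k powi - int (w k n)"
    by (simp add: power_int_minus power_inverse)
qed

text \<open>Each \<open>s\<close> is a unit of the localization at \<open>P\<close>, so locally
  every interpolation denominator divides \<open>inverse (sigma \<pi> n)\<close>.\<close>

lemma local_denominators:
  assumes P: "t_maximal D P"
  shows "\<exists>u. (\<forall>i. u i \<in> D) \<and> (\<forall>j\<le>n. \<exists>s\<in>D - P. \<exists>e\<in>D.
    (\<Prod>i\<in>{..n} - {j}. u j - u i) * e = s * inverse (sigma \<pi> n))"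
proof (cases "enat (Suc n) \<le> ideal_norm D P")
  case True
  then obtain c where c: "\<And>i. i < Suc n \<Longrightarrow> c i \<in> D"
    "\<And>i j. i < Suc n \<Longrightarrow> j < Suc n \<Longrightarrow> i \<noteq> j \<Longrightarrow> c i - c j \<notin> P"
    using incongruent_elements[OF t_maximal_ideal[OF P]] by metis
  \<comment> \<open>\<open>c\<close> is controlled only up to \<open>n\<close>; truncating the index
    keeps every value of \<open>u\<close> in \<open>D\<close>.\<close>
  define u where "u i = c (min i n)" for i
  have mem: "u i \<in> D" for i
    unfolding u_def by (rule c(1)) simp
  moreover have "\<exists>s\<in>D - P. \<exists>e\<in>D. (\<Prod>i\<in>{..n} - {j}. u j - u i) * e = s * inverse (sigma \<pi> n)"
    if "j \<le> n" for j
  \<comment> \<open>The product of differences itself serves as \<open>s\<close>, with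
    \<open>inverse (sigma \<pi> n)\<close>, an element of \<open>D\<close>, as cofactor.\<close>
  proof (intro bexI)
    show "(\<Prod>i\<in>{..n} - {j}. u j - u i) \<in> D - P"
    proof (rule t_maximal_prod_notin[OF P])
      show "u j - u i \<in> D - P" if "i \<in> {..n} - {j}" for i
        using that \<open>j \<le> n\<close> c(2)[of j i] mem[of i] mem[of j] by (auto simp: u_def intro: diff_mem)
    qed
    show "inverse (sigma \<pi> n) \<in> D"
      by (simp add: inverse_sigma prod_mem power_mem pi_mem)
  qed simp
  ultimately show ?thesis
    by blast
next
  case False
  then obtain q where q: "ideal_norm D P = enat q" "q \<le> n"
    by (cases "ideal_norm D P") auto
  have "q > 1"
    using ideal_norm_ge_2[OF P] q by simp
  obtain c where c: "\<And>i. i < q \<Longrightarrow> c i \<in> D"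
    "\<And>i j. i < q \<Longrightarrow> j < q \<Longrightarrow> i \<noteq> j \<Longrightarrow> c i - c j \<notin> P"
    using incongruent_elements[OF t_maximal_ideal[OF P], of q] q by auto
  obtain L where L: "n < q ^ L"
    using power_le_atMost[OF \<open>q > 1\<close>] by blast
  define u where "u = digit_transfer q c (\<pi> q) L"
  have "u i \<in> D" for i
    unfolding u_def using \<open>q > 1\<close> c(1) pi_mem by (intro digit_transfer_mem) auto
  moreover have "\<exists>s\<in>D - P. \<exists>e\<in>D. (\<Prod>i\<in>{..n} - {j}. u j - u i) * e = s * inverse (sigma \<pi> n)"
    if "j \<le> n" for j
  proof -
    have "\<exists>s\<in>D - P. \<exists>e\<le>w q n. (\<Prod>i\<in>{..n} - {j}. u j - u i) = s * \<pi> q ^ e"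
      unfolding u_def
      by (rule digit_transfer_denominator)
        (use P \<open>q > 1\<close> pi_in_t_maximal[OF P q(1)] c L \<open>j \<le> n\<close> in auto)
    then obtain s e where s: "s \<in> D - P" "e \<le> w q n"
      "(\<Prod>i\<in>{..n} - {j}. u j - u i) = s * \<pi> q ^ e"
      by blast
    \<comment> \<open>The cofactor consists of the powers of the other \<open>\<pi> k\<close> and
      the surplus power of \<open>\<pi> q\<close>.\<close>
    let ?r = "\<Prod>k\<in>{1<..n} - {q}. \<pi> k ^ w k n"
    have "inverse (sigma \<pi> n) = \<pi> q ^ w q n * ?r"
      unfolding inverse_sigma using \<open>q > 1\<close> q(2) by (simp add: prod.remove[of _ q])
    moreover have "\<pi> q ^ w q n = \<pi> q ^ e * \<pi> q ^ (w q n - e)"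
      using s(2) by (simp flip: power_add)
    ultimately have "(\<Prod>i\<in>{..n} - {j}. u j - u i) * (\<pi> q ^ (w q n - e) * ?r) =
        s * inverse (sigma \<pi> n)"
      by (simp add: s(3))
    moreover have "\<pi> q ^ (w q n - e) * ?r \<in> D"
      by (intro mult_mem prod_mem power_mem pi_mem)
    ultimately show ?thesis
      using s(1) by blast
  qed
  ultimately show ?thesis
    by blast
qed

lemma char_ideal_subset: "char_ideal D n \<subseteq> cyclic_module D (sigma \<pi> n)"
proof
  fix x
  assume "x \<in> char_ideal D n"
  then obtain f where f: "f \<in> int_valued D" "degree f \<le> n" "x = coeff f n"
    by (auto simp: char_ideal_def)
  have "x * inverse (sigma \<pi> n) \<in> D"
  proof (rule memI_t_maximal)
    fix P
    assume P: "t_maximal D P"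
    obtain u s e where u: "\<And>i. u i \<in> D" and se: "\<And>j. j \<le> n \<Longrightarrow> s j \<in> D - P \<and> e j \<in> D \<and>
        (\<Prod>i\<in>{..n} - {j}. u j - u i) * e j = s j * inverse (sigma \<pi> n)"
      using local_denominators[OF P, of n] by metis
    let ?\<Delta> = "\<lambda>j. \<Prod>i\<in>{..n} - {j}. u j - u i"
    have s0: "s j \<noteq> 0" if "j \<le> n" for j
      using se[OF that] ideal_zero[OF t_maximal_ideal[OF P]] by auto
    have \<Delta>0: "?\<Delta> j \<noteq> 0" if "j \<le> n" for j
      using se[OF that] s0[OF that] sigma_nonzero[of n] by force
    \<comment> \<open>Distinctness of the points is read off from their nonzero products of
      differences.\<close>
    have "inj_on u {..n}"
    proof (rule inj_onI, rule ccontr)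
      fix i j
      assume "i \<in> {..n}" "j \<in> {..n}" "u i = u j" "i \<noteq> j"
      then have "?\<Delta> j = 0"
        by (intro prod_zero bexI[of _ i]) auto
      then show False
        using \<Delta>0 \<open>j \<in> {..n}\<close> by simp
    qed
    then have "x = (\<Sum>j\<le>n. poly f (u j) / ?\<Delta> j)"
      using f(2,3) coeff_eq_divided_difference by blast
    \<comment> \<open>The product of all \<open>s j\<close> is a common denominator for the
      interpolation sum and stays outside \<open>P\<close>.\<close>
    then have "prod s {..n} * (x * inverse (sigma \<pi> n)) =
        (\<Sum>j\<le>n. prod s {..n} * (poly f (u j) / ?\<Delta> j * inverse (sigma \<pi> n)))"
      by (simp only: sum_distrib_left sum_distrib_right)
    also have "\<dots> = (\<Sum>j\<le>n. prod s ({..n} - {j}) * (poly f (u j) * e j))"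
    proof (intro sum.cong refl)
      fix j
      assume "j \<in> {..n}"
      then have "s j * inverse (sigma \<pi> n) = ?\<Delta> j * e j"
        using se[of j] by auto
      then have "s j * (inverse (sigma \<pi> n) / ?\<Delta> j) = ?\<Delta> j * e j / ?\<Delta> j"
        by (simp only: times_divide_eq_right)
      also have "\<dots> = e j"
        using \<Delta>0[of j] \<open>j \<in> {..n}\<close> by (intro nonzero_mult_div_cancel_left) auto
      finally have cancel: "s j * (inverse (sigma \<pi> n) / ?\<Delta> j) = e j" .
      have "prod s {..n} * (poly f (u j) / ?\<Delta> j * inverse (sigma \<pi> n)) =
          prod s ({..n} - {j}) * (poly f (u j) * (s j * (inverse (sigma \<pi> n) / ?\<Delta> j)))"
        using \<open>j \<in> {..n}\<close> by (simp add: prod.remove mult_ac)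
      then show "prod s {..n} * (poly f (u j) / ?\<Delta> j * inverse (sigma \<pi> n)) =
          prod s ({..n} - {j}) * (poly f (u j) * e j)"
        unfolding cancel .
    qed
    also have "\<dots> \<in> D"
      using f(1) u se by (intro sum_mem mult_mem prod_mem) (auto simp: int_valued_def)
    finally have "prod s {..n} * (x * inverse (sigma \<pi> n)) \<in> D" .
    moreover have "prod s {..n} \<in> D - P"
      using P se by (intro t_maximal_prod_notin) auto
    ultimately show "\<exists>s\<in>D - P. s * (x * inverse (sigma \<pi> n)) \<in> D"
      by blast
  qed
  then show "x \<in> cyclic_module D (sigma \<pi> n)"
    unfolding cyclic_module_def using sigma_nonzero[of n]
    by (intro image_eqI[of _ _ "x * inverse (sigma \<pi> n)"]) auto
qed

text \<open>Every summand has degree at most \<open>n\<close>, and the choice of \<open>a\<close>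
  makes the coefficients at \<open>n\<close> add up to \<open>sigma \<pi> n\<close>, which is
  nonzero. For \<open>n \<le> 1\<close>, \<open>sigma \<pi> n\<close> is the empty product.\<close>

lemma G_poly_properties:
  assumes a: "\<forall>n>1. (\<forall>k\<in>{1<..n}. a k n \<in> D) \<and>
      sigma \<pi> n = (\<Sum>k\<in>{1<..n}. a k n * \<pi> k powi - int (w k n))"
  shows "G_poly \<pi> a n \<in> int_valued D" "degree (G_poly \<pi> a n) = n"
    "lead_coeff (G_poly \<pi> a n) = sigma \<pi> n"
proof -
  show "G_poly \<pi> a n \<in> int_valued D"
    unfolding G_poly_def using a
    by (auto simp: int_valued_X int_valued_1 F_digit_poly_int_valued
        intro!: int_valued_sum int_valued_smult)
  have "degree (G_poly \<pi> a n) = n \<and> lead_coeff (G_poly \<pi> a n) = sigma \<pi> n"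
  proof (cases "n > 1")
    case False
    then have "n = 0 \<or> n = 1"
      by auto
    then show ?thesis
      by (auto simp: G_poly_def sigma_def)
  next
    case True
    then have G: "G_poly \<pi> a n = (\<Sum>k\<in>{1<..n}. smult (a k n) (F_digit_poly \<pi> k n))"
      by (simp add: G_poly_def)
    have "coeff (F_digit_poly \<pi> k n) n = \<pi> k powi - int (w k n)" if "k > 1" for k
      using F_digit_poly_degree[OF that, of n] by simp
    then have coeff: "coeff (G_poly \<pi> a n) n = sigma \<pi> n"
      using a True unfolding G coeff_sum by simp
    have "degree (G_poly \<pi> a n) \<le> n"
      unfolding G by (intro degree_sum_le)
        (auto intro: order_trans[OF degree_smult_le] simp: F_digit_poly_degree)
    moreover have "n \<le> degree (G_poly \<pi> a n)"
      using coeff sigma_nonzero[of n] by (intro le_degree) simp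
    ultimately show ?thesis
      using coeff by simp
  qed
  then show "degree (G_poly \<pi> a n) = n" "lead_coeff (G_poly \<pi> a n) = sigma \<pi> n"
    by auto
qed

lemma G_poly_regular_basis:
  assumes "\<forall>n>1. (\<forall>k\<in>{1<..n}. a k n \<in> D) \<and>
      sigma \<pi> n = (\<Sum>k\<in>{1<..n}. a k n * \<pi> k powi - int (w k n))"
  shows "regular_basis D (range (G_poly \<pi> a))"
proof (rule regular_basisI)
  note G = G_poly_properties[OF assms]
  show "G_poly \<pi> a n \<in> int_valued D" for n
    by (rule G(1))
  show "degree (G_poly \<pi> a n) = n" for n
    by (rule G(2))
  show "lead_coeff (G_poly \<pi> a n) \<noteq> 0" for n
    unfolding G(3) by (rule sigma_nonzero)
  show "char_ideal D n \<subseteq> cyclic_module D (lead_coeff (G_poly \<pi> a n))" for n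
    unfolding G(3) by (rule char_ideal_subset)
qed

lemma sigma_coefficients_exist:
  "\<exists>a. \<forall>n>1. (\<forall>k\<in>{1<..n}. a k n \<in> D) \<and>
    sigma \<pi> n = (\<Sum>k\<in>{1<..n}. a k n * \<pi> k powi - int (w k n))"
proof -
  have "\<forall>n. \<exists>a. n > 1 \<longrightarrow> (\<forall>k\<in>{1<..n}. a k \<in> D) \<and>
      sigma \<pi> n = (\<Sum>k\<in>{1<..n}. a k * \<pi> k powi - int (w k n))"
    using sigma_combination by blast
  then obtain a where "\<forall>n. n > 1 \<longrightarrow> (\<forall>k\<in>{1<..n}. a n k \<in> D) \<and>
      sigma \<pi> n = (\<Sum>k\<in>{1<..n}. a n k * \<pi> k powi - int (w k n))"
    by metis
  then show ?thesis
    by (intro exI[of _ "\<lambda>k n. a n k"])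
qed

lemma char_ideal_eq: "char_ideal D n = cyclic_module D (sigma \<pi> n)"
proof
  obtain a where "\<forall>n>1. (\<forall>k\<in>{1<..n}. a k n \<in> D) \<and>
      sigma \<pi> n = (\<Sum>k\<in>{1<..n}. a k n * \<pi> k powi - int (w k n))"
    using sigma_coefficients_exist by blast
  note G = G_poly_properties[OF this]
  \<comment> \<open>Multiples of \<open>G_poly \<pi> a n\<close> by elements of \<open>D\<close>
    realize every multiple of \<open>sigma \<pi> n\<close> as a coefficient.\<close>
  show "cyclic_module D (sigma \<pi> n) \<subseteq> char_ideal D n"
  proof
    fix x
    assume "x \<in> cyclic_module D (sigma \<pi> n)"
    then obtain d where d: "d \<in> D" "x = d * sigma \<pi> n"
      by (auto simp: cyclic_module_def)
    let ?f = "smult d (G_poly \<pi> a n)"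
    have "x = coeff ?f n"
      using G(2,3)[of n] d by simp
    moreover have "degree ?f \<le> n"
      using degree_smult_le[of d "G_poly \<pi> a n"] by (simp add: G(2))
    ultimately show "x \<in> char_ideal D n"
      unfolding char_ideal_def using int_valued_smult[OF d(1) G(1)[of n]] by blast
  qed
qed (rule char_ideal_subset)

end

theorem theorem4p2:
  fixes D :: "'k::field set" and \<pi> :: "nat \<Rightarrow> 'k"
  assumes dom: "domain_with_quotient_field D"
    and C1: "polynomially_L_regular D"
    and C2: "\<And>n. finite {P. t_maximal D P \<and> ideal_norm D P \<le> enat n}"
    and C3: "\<And>q. primepow q \<Longrightarrow> principal_ideal_of D (Pi_ideal D q)"
    and gen: "\<And>n. \<pi> n \<in> D \<and> Pi_ideal D n = cyclic_module D (\<pi> n)"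
  shows "(\<forall>n. char_ideal D n = cyclic_module D (sigma \<pi> n)) \<and>
    (\<exists>B. regular_basis D B) \<and>
    (\<forall>n. \<pi> n \<noteq> 0 \<and> F_poly \<pi> n \<in> int_valued D) \<and>
    (\<forall>k>1. \<forall>n. F_digit_poly \<pi> k n \<in> int_valued D \<and>
       degree (F_digit_poly \<pi> k n) = n \<and>
       lead_coeff (F_digit_poly \<pi> k n) = \<pi> k powi - int (w k n)) \<and>
    (\<forall>n>1. \<exists>a. (\<forall>k\<in>{1<..n}. a k \<in> D) \<and>
       sigma \<pi> n = (\<Sum>k\<in>{1<..n}. a k * \<pi> k powi - int (w k n))) \<and>
    (\<forall>a. (\<forall>n>1. (\<forall>k\<in>{1<..n}. a k n \<in> D) \<and>
            sigma \<pi> n = (\<Sum>k\<in>{1<..n}. a k n * \<pi> k powi - int (w k n))) \<longrightarrow>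
       (\<forall>n. G_poly \<pi> a n \<in> int_valued D \<and>
          degree (G_poly \<pi> a n) = n \<and> lead_coeff (G_poly \<pi> a n) = sigma \<pi> n) \<and>
       regular_basis D (range (G_poly \<pi> a)))"
proof -
  interpret norm_ideal_generators D \<pi>
    by unfold_locales (fact dom C2 gen)+
  show ?thesis
  proof (intro conjI allI impI)
    show "\<exists>B. regular_basis D B"
      using sigma_coefficients_exist G_poly_regular_basis by blast
    fix n
    show "char_ideal D n = cyclic_module D (sigma \<pi> n)"
      by (rule char_ideal_eq)
    show "\<pi> n \<noteq> 0"
      by (rule pi_nonzero)
    show "F_poly \<pi> n \<in> int_valued D"
      by (rule F_poly_int_valued)
    show "\<exists>a. (\<forall>k\<in>{1<..n}. a k \<in> D) \<and>
       sigma \<pi> n = (\<Sum>k\<in>{1<..n}. a k * \<pi> k powi - int (w k n))" if "n > 1"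
      using that by (rule sigma_combination)
    fix k :: nat
    assume "k > 1"
    then show "F_digit_poly \<pi> k n \<in> int_valued D" "degree (F_digit_poly \<pi> k n) = n"
      "lead_coeff (F_digit_poly \<pi> k n) = \<pi> k powi - int (w k n)"
      using F_digit_poly_int_valued F_digit_poly_degree by blast+
  next
    fix a
    assume a: "\<forall>n>1. (\<forall>k\<in>{1<..n}. a k n \<in> D) \<and>
      sigma \<pi> n = (\<Sum>k\<in>{1<..n}. a k n * \<pi> k powi - int (w k n))"
    show "regular_basis D (range (G_poly \<pi> a))"
      using a by (rule G_poly_regular_basis)
    fix n
    show "G_poly \<pi> a n \<in> int_valued D" "degree (G_poly \<pi> a n) = n"
      "lead_coeff (G_poly \<pi> a n) = sigma \<pi> n"
      using G_poly_properties[OF a] by blast+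
  qed
qed

end
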